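(* Let $G$ be a Lie group with Lie algebra $\mathfrak{g}$, let $\ell:2\mathfrak{g}\to\mathbb{R}$ be the reduced Lagrangian of a left-invariant second-order Lagrangian, let $h>0$, let $(a_{ij})_{i,j=1}^s$, $(b_i)_{i=1}^s$ be Runge--Kutta coefficients, and let $\tau:\mathfrak{g}\to G$ be a local approximation of the exponential map. Assume that $\ell$ allows the internal variables $G_k^i,\Xi_k^i,V_k^i,\mu_k^i,\nu_k^i$ to be eliminated from the discrete HOHP equations, so that these induce a discrete flow map $F:T^*(TG)\to T^*(TG)$, i.e. every solution $\gamma\in\mathcal{C}_d$ of the discrete HOHP principle with initial condition $(g_0,\xi_0,\mu_0,\nu_0)$ satisfies $F^k(g_0,\xi_0,\mu_0,\nu_0)=(g_k,\xi_k,\mu_k,\nu_k)$. Then $F$ is symplectic: $F^*\omega=\omega$, where $\omega$ is the canonical symplectic form on $T^*(TG)$.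
   Context: $2\mathfrak{g}=\mathfrak{g}\times\mathfrak{g}$, $\ell=\ell(\xi,u)$ smooth. The map $\tau$ is an analytic diffeomorphism from a neighbourhood of $0\in\mathfrak{g}$ onto a neighbourhood of $e\in G$, with $\tau(0)=e$, $\tau(-\eta)\tau(\eta)=e$; its right-trivialised differential is $d\tau_\xi(\eta)=(T_\xi\tau(\eta))\tau(\xi)^{-1}$, with inverse $d\tau_\xi^{-1}$. All arguments of $\tau,\tau^{-1}$ are assumed to lie in these neighbourhoods. For $N\ge1$ the discrete path space is $\mathcal{C}_d=(G\times\mathfrak{g})\times(G\times\mathfrak{g}\times2\mathfrak{g}^* )^N\times(G\times2\mathfrak{g}\times2\mathfrak{g}^* )^{Ns}$ with elements $$\gamma=\big\{(g_0,\xi_0),(g_k,\xi_k,\check\mu_k,\nu_k)_{k=1}^N,(G_k^i,\Xi_k^i,V_k^i,\mu_k^i,\nu_k^i)_{1\le i\le s,\,0\le k\le N-1}\big\},$$ and the discrete HOHP functional $S:\mathcal{C}_d\to\mathbb{R}$ is \begin{align*}S=h\sum_{k=0}^{N-1}\Big\{&\sum_{i=1}^s\Big[b_i\ell(\Xi_k^i,V_k^i)+\Big\langle\mu_k^i,\tfrac1h\tau^{-1}(g_k^{-1}G_k^i)-\sum_{j}a_{ij}\Xi_k^j\Big\rangle+\Big\langle\nu_k^i,\tfrac1h(\Xi_k^i-\xi_k)-\sum_{j}a_{ij}V_k^j\Big\rangle\Big]\\&+\Big\langle\check\mu_{k+1},\tfrac1h\tau^{-1}(g_k^{-1}g_{k+1})-\sum_{i}b_i\Xi_k^i\Big\rangle+\Big\langle\nu_{k+1},\tfrac1h(\xi_{k+1}-\xi_k)-\sum_{i}b_iV_k^i\Big\rangle\Big\}.\end{align*}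 $\gamma$ is a solution of the discrete HOHP principle if $dS(\delta\gamma)=0$ for all $\delta\gamma\in T_\gamma\mathcal{C}_d$ with $\delta g_0=\delta g_N=0$, $\delta\xi_0=\delta\xi_N=0$; the resulting stationarity equations are the discrete HOHP equations. Notation: $\Xi_{k+1}=\sum_jb_j\Xi_k^j$, $\Theta_k^i=\sum_ja_{ij}\Xi_k^j$, $\mu_k=(d\tau^{-1}_{-h\Xi_k})^*\check\mu_k$ for $k=1,\dots,N$; the initial condition of a solution is $(g_0,\xi_0,\mu_0,\nu_0)$ with $\nu_0=\nu_1+\sum_i\nu_0^i$ and $\mu_0=(d\tau^{-1}_{h\Xi_1})^*\check\mu_1+\sum_i(d\tau^{-1}_{h\Theta_0^i})^*\mu_0^i$. The elimination assumption means: for each $z\in T^*(TG)$ there is a unique solution with initial condition $z$, depending smoothly on $z$ (in particular $F$ is smooth). $T^*(TG)$ is identified with $G\times\mathfrak{g}\times2\mathfrak{g}^*\ni(g,\xi,\mu,\nu)$ by left trivialisation; for tangent vectors $v_i=(\delta g_i,\delta\xi_i,\delta\mu_i,\delta\nu_i)$ at $(g,\xi,\mu,\nu)$ and $\eta_i=g^{-1}\delta g_i$, $$\omega(v_1,v_2)=-\langle\delta\mu_1,\eta_2\rangle-\langle\delta\nu_1,\delta\xi_2\rangle+\langle\delta\mu_2,\eta_1\rangle+\langle\delta\nu_2,\delta\xi_1\rangle+\langle\mu,[\eta_1,\eta_2]\rangle.$$ *)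

theory Defs
  imports "HOL-Analysis.Analysis" "HOL-Algebra.Group"
begin

section \<open>Smooth and real-analytic maps between vector spaces\<close>

text \<open>Only used on open subsets of finite-dimensional spaces, where differentiability of all
  iterated directional derivatives is equivalent to being of class \<open>C\<^sup>\<infinity>\<close>.\<close>

primrec Ck_on :: "nat \<Rightarrow> 'a::real_normed_vector set \<Rightarrow> ('a \<Rightarrow> 'b::real_normed_vector) \<Rightarrow> bool" where
  "Ck_on 0 S f \<longleftrightarrow> continuous_on S f"
| "Ck_on (Suc k) S f \<longleftrightarrow>
     (\<forall>x\<in>S. f differentiable (at x)) \<and> (\<forall>v. Ck_on k S (\<lambda>x. frechet_derivative f (at x) v))"

definition smooth_on :: "'a::real_normed_vector set \<Rightarrow> ('a \<Rightarrow> 'b::real_normed_vector) \<Rightarrow> bool" where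
  "smooth_on S f \<longleftrightarrow> (\<forall>k. Ck_on k S f)"

text \<open>A smooth map that near every point is the sum of a power series in several variables;
  \<open>\<alpha>\<close> ranges over the multi-indices.\<close>

definition real_analytic_on :: "'a::euclidean_space set \<Rightarrow> ('a \<Rightarrow> 'b::real_normed_vector) \<Rightarrow> bool" where
  "real_analytic_on S f \<longleftrightarrow> smooth_on S f \<and>
     (\<forall>x\<in>S. \<exists>r>0. \<exists>c :: ('a \<Rightarrow> nat) \<Rightarrow> 'b. \<forall>y\<in>ball x r.
        ((\<lambda>\<alpha>. (\<Prod>b\<in>Basis. ((y - x) \<bullet> b) ^ \<alpha> b) *\<^sub>R c \<alpha>) has_sum f y) (Basis \<rightarrow>\<^sub>E UNIV))"

section \<open>Manifolds and Lie groups\<close>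

type_synonym ('g, 'e) chart = "'g set \<times> ('g \<Rightarrow> 'e)"

definition atlas :: "('g::topological_space, 'e::real_normed_vector) chart set \<Rightarrow> bool" where
  "atlas A \<longleftrightarrow>
     (\<forall>(U, \<phi>)\<in>A. open U \<and> open (\<phi> ` U) \<and> homeomorphism U (\<phi> ` U) \<phi> (inv_into U \<phi>)) \<and>
     (\<Union>(U, \<phi>)\<in>A. U) = UNIV"

definition vec_atlas :: "('e::real_normed_vector, 'e) chart set" where
  "vec_atlas = {(UNIV, id)}"

definition prod_atlas ::
  "('g, 'e) chart set \<Rightarrow> ('h, 'f) chart set \<Rightarrow> ('g \<times> 'h, 'e \<times> 'f) chart set" where
  "prod_atlas A B = (\<lambda>((U, \<phi>), (V, \<psi>)). (U \<times> V, map_prod \<phi> \<psi>)) ` (A \<times> B)"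

text \<open>\<open>f\<close> is, on the open set \<open>S\<close>, a map of regularity class \<open>R\<close> (instantiated with
  \<^const>\<open>smooth_on\<close> or \<^const>\<open>real_analytic_on\<close>) with respect to the atlases \<open>A\<close> and \<open>B\<close>.\<close>

definition manifold_map ::
  "('e::real_normed_vector set \<Rightarrow> ('e \<Rightarrow> 'f::real_normed_vector) \<Rightarrow> bool) \<Rightarrow>
   ('g::topological_space, 'e) chart set \<Rightarrow> ('h::topological_space, 'f) chart set \<Rightarrow>
   'g set \<Rightarrow> ('g \<Rightarrow> 'h) \<Rightarrow> bool" where
  "manifold_map R A B S f \<longleftrightarrow> continuous_on S f \<and>
     (\<forall>(U, \<phi>)\<in>A. \<forall>(V, \<psi>)\<in>B. R (\<phi> ` (S \<inter> U \<inter> f -` V)) (\<lambda>x. \<psi> (f (inv_into U \<phi> x))))"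

text \<open>The underlying manifold is the whole type \<open>'g\<close>, the model space is \<open>'e\<close>.\<close>

definition lie_group ::
  "'g::{t2_space, second_countable_topology} monoid \<Rightarrow> ('g, 'e::euclidean_space) chart set \<Rightarrow> bool" where
  "lie_group G A \<longleftrightarrow> group G \<and> carrier G = UNIV \<and> atlas A \<and>
     manifold_map smooth_on A A UNIV (\<lambda>x. x) \<and>
     manifold_map smooth_on (prod_atlas A A) A UNIV (\<lambda>(x, y). x \<otimes>\<^bsub>G\<^esub> y) \<and>
     manifold_map smooth_on A A UNIV (\<lambda>x. inv\<^bsub>G\<^esub> x)"

definition analytic_lie_group ::
  "'g::{t2_space, second_countable_topology} monoid \<Rightarrow> ('g, 'e::euclidean_space) chart set \<Rightarrow> bool" where
  "analytic_lie_group G A \<longleftrightarrow> group G \<and> carrier G = UNIV \<and> atlas A \<and>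
     manifold_map real_analytic_on A A UNIV (\<lambda>x. x) \<and>
     manifold_map real_analytic_on (prod_atlas A A) A UNIV (\<lambda>(x, y). x \<otimes>\<^bsub>G\<^esub> y) \<and>
     manifold_map real_analytic_on A A UNIV (\<lambda>x. inv\<^bsub>G\<^esub> x)"

definition compatible ::
  "('g::topological_space, 'e::real_normed_vector) chart set \<Rightarrow> ('g, 'e) chart set \<Rightarrow> bool" where
  "compatible A B \<longleftrightarrow>
     manifold_map smooth_on A B UNIV (\<lambda>x. x) \<and> manifold_map smooth_on B A UNIV (\<lambda>x. x)"

section \<open>The Lie algebra\<close>

text \<open>A chart \<open>\<kappa>\<close> around the unit identifies the Lie algebra, i.e. the tangent space at the unit,
  with the model space \<open>'e\<close>, by means of the differential of \<open>\<kappa>\<close> at the unit.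
  \<open>coord\<close> is \<open>\<kappa>\<close>, shifted so that the unit goes to 0, and \<open>point\<close> is its local inverse.
  A tangent vector at \<open>g\<close> is represented by its left trivialisation \<open>\<eta> = g\<^sup>-\<^sup>1 \<delta>g\<close> in \<open>'e\<close>; it is the
  velocity at \<open>t = 0\<close> of the curve \<open>t \<mapsto> g point(t \<eta>)\<close>.\<close>

definition unit_chart :: "'g monoid \<Rightarrow> ('g, 'e) chart set \<Rightarrow> ('g, 'e) chart \<Rightarrow> bool" where
  "unit_chart G A \<kappa> \<longleftrightarrow> \<kappa> \<in> A \<and> \<one>\<^bsub>G\<^esub> \<in> fst \<kappa>"

definition coord :: "'g monoid \<Rightarrow> ('g, 'e::euclidean_space) chart \<Rightarrow> 'g \<Rightarrow> 'e" where
  "coord G \<kappa> g = snd \<kappa> g - snd \<kappa> \<one>\<^bsub>G\<^esub>"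

definition point :: "'g monoid \<Rightarrow> ('g, 'e::euclidean_space) chart \<Rightarrow> 'e \<Rightarrow> 'g" where
  "point G \<kappa> \<eta> = inv_into (fst \<kappa>) (snd \<kappa>) (snd \<kappa> \<one>\<^bsub>G\<^esub> + \<eta>)"

definition Ad :: "'g monoid \<Rightarrow> ('g, 'e::euclidean_space) chart \<Rightarrow> 'g \<Rightarrow> 'e \<Rightarrow> 'e" where
  "Ad G \<kappa> g \<eta> =
     frechet_derivative (\<lambda>x. coord G \<kappa> (g \<otimes>\<^bsub>G\<^esub> point G \<kappa> x \<otimes>\<^bsub>G\<^esub> inv\<^bsub>G\<^esub> g)) (at 0) \<eta>"

definition lie_bracket :: "'g monoid \<Rightarrow> ('g, 'e::euclidean_space) chart \<Rightarrow> 'e \<Rightarrow> 'e \<Rightarrow> 'e" where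
  "lie_bracket G \<kappa> \<xi> \<eta> = frechet_derivative (\<lambda>x. Ad G \<kappa> (point G \<kappa> x) \<eta>) (at 0) \<xi>"

type_synonym 'e dual = "'e \<Rightarrow>\<^sub>L real"

definition dual_map :: "('e::real_normed_vector \<Rightarrow> 'e) \<Rightarrow> 'e dual \<Rightarrow> 'e dual" where
  "dual_map L \<mu> = Blinfun (\<lambda>\<eta>. blinfun_apply \<mu> (L \<eta>))"

section \<open>The map \<open>\<tau>\<close>\<close>

text \<open>The existentially quantified \<open>B\<close> is the (essentially unique) analytic structure
  underlying the Lie group.\<close>

definition local_diffeo_at_unit ::
  "'g::{t2_space, second_countable_topology} monoid \<Rightarrow> ('g, 'e::euclidean_space) chart set \<Rightarrow>
   'e set \<Rightarrow> ('e \<Rightarrow> 'g) \<Rightarrow> bool" where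
  "local_diffeo_at_unit G A U \<tau> \<longleftrightarrow>
     open U \<and> 0 \<in> U \<and> open (\<tau> ` U) \<and> inj_on \<tau> U \<and>
     (\<exists>B. analytic_lie_group G B \<and> compatible A B \<and>
          manifold_map real_analytic_on vec_atlas B U \<tau> \<and>
          manifold_map real_analytic_on B vec_atlas (\<tau> ` U) (inv_into U \<tau>)) \<and>
     \<tau> 0 = \<one>\<^bsub>G\<^esub> \<and>
     (\<forall>\<eta>\<in>U. - \<eta> \<in> U \<and> \<tau> (- \<eta>) \<otimes>\<^bsub>G\<^esub> \<tau> \<eta> = \<one>\<^bsub>G\<^esub>)"

definition dtau :: "'g monoid \<Rightarrow> ('g, 'e::euclidean_space) chart \<Rightarrow> ('e \<Rightarrow> 'g) \<Rightarrow> 'e \<Rightarrow> 'e \<Rightarrow> 'e" where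
  "dtau G \<kappa> \<tau> \<xi> \<eta> = frechet_derivative (\<lambda>x. coord G \<kappa> (\<tau> x \<otimes>\<^bsub>G\<^esub> inv\<^bsub>G\<^esub> (\<tau> \<xi>))) (at \<xi>) \<eta>"

definition dtau_inv :: "'g monoid \<Rightarrow> ('g, 'e::euclidean_space) chart \<Rightarrow> ('e \<Rightarrow> 'g) \<Rightarrow> 'e \<Rightarrow> 'e \<Rightarrow> 'e" where
  "dtau_inv G \<kappa> \<tau> \<xi> = inv_into UNIV (dtau G \<kappa> \<tau> \<xi>)"

section \<open>Discrete paths and the discrete HOHP principle\<close>

text \<open>The \<open>s\<close> stages are indexed by the finite type \<open>'s\<close>. The components are
  \<open>g\<^sub>k\<close>, \<open>\<xi>\<^sub>k\<close>, \<open>\<mu>\<^sub>k\<close> (with check), \<open>\<nu>\<^sub>k\<close> and the internal variables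
  \<open>G\<^sub>k\<^sup>i\<close>, \<open>\<Xi>\<^sub>k\<^sup>i\<close>, \<open>V\<^sub>k\<^sup>i\<close>, \<open>\<mu>\<^sub>k\<^sup>i\<close>, \<open>\<nu>\<^sub>k\<^sup>i\<close>.\<close>

record (overloaded) ('g, 'e, 's) dpath =
  node_g :: "nat \<Rightarrow> 'g"
  node_xi :: "nat \<Rightarrow> 'e"
  node_cmu :: "nat \<Rightarrow> 'e \<Rightarrow>\<^sub>L real"
  node_nu :: "nat \<Rightarrow> 'e \<Rightarrow>\<^sub>L real"
  st_g :: "nat \<Rightarrow> 's \<Rightarrow> 'g"
  st_xi :: "nat \<Rightarrow> 's \<Rightarrow> 'e"
  st_v :: "nat \<Rightarrow> 's \<Rightarrow> 'e"
  st_mu :: "nat \<Rightarrow> 's \<Rightarrow> 'e \<Rightarrow>\<^sub>L real"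
  st_nu :: "nat \<Rightarrow> 's \<Rightarrow> 'e \<Rightarrow>\<^sub>L real"

definition path_space :: "nat \<Rightarrow> ('g, 'e::euclidean_space, 's::finite) dpath set" where
  "path_space N = {\<gamma>.
     node_g \<gamma> \<in> extensional {0..N} \<and> node_xi \<gamma> \<in> extensional {0..N} \<and>
     node_cmu \<gamma> \<in> extensional {1..N} \<and> node_nu \<gamma> \<in> extensional {1..N} \<and>
     st_g \<gamma> \<in> extensional {..<N} \<and> st_xi \<gamma> \<in> extensional {..<N} \<and>
     st_v \<gamma> \<in> extensional {..<N} \<and> st_mu \<gamma> \<in> extensional {..<N} \<and>
     st_nu \<gamma> \<in> extensional {..<N}}"

context
  fixes G :: "'g::{t2_space, second_countable_topology} monoid"
    and A :: "('g, 'e::euclidean_space) chart set"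
    and \<kappa> :: "('g, 'e) chart"
    and U :: "'e set" and \<tau> :: "'e \<Rightarrow> 'g"
    and l :: "'e \<times> 'e \<Rightarrow> real"
    and h :: real and a :: "'s::finite \<Rightarrow> 's \<Rightarrow> real" and b :: "'s \<Rightarrow> real"
    and N :: nat
begin

definition action :: "('g, 'e, 's) dpath \<Rightarrow> real" where
  "action \<gamma> = h * (\<Sum>k<N.
     (\<Sum>i\<in>UNIV.
        b i * l (st_xi \<gamma> k i, st_v \<gamma> k i)
        + blinfun_apply (st_mu \<gamma> k i)
            ((1 / h) *\<^sub>R inv_into U \<tau> (inv\<^bsub>G\<^esub> (node_g \<gamma> k) \<otimes>\<^bsub>G\<^esub> st_g \<gamma> k i)
             - (\<Sum>j\<in>UNIV. a i j *\<^sub>R st_xi \<gamma> k j))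
        + blinfun_apply (st_nu \<gamma> k i)
            ((1 / h) *\<^sub>R (st_xi \<gamma> k i - node_xi \<gamma> k)
             - (\<Sum>j\<in>UNIV. a i j *\<^sub>R st_v \<gamma> k j)))
     + blinfun_apply (node_cmu \<gamma> (k + 1))
         ((1 / h) *\<^sub>R inv_into U \<tau> (inv\<^bsub>G\<^esub> (node_g \<gamma> k) \<otimes>\<^bsub>G\<^esub> node_g \<gamma> (k + 1))
          - (\<Sum>i\<in>UNIV. b i *\<^sub>R st_xi \<gamma> k i))
     + blinfun_apply (node_nu \<gamma> (k + 1))
         ((1 / h) *\<^sub>R (node_xi \<gamma> (k + 1) - node_xi \<gamma> k)
          - (\<Sum>i\<in>UNIV. b i *\<^sub>R st_v \<gamma> k i)))"

text \<open>The arguments of \<open>\<tau>\<^sup>-\<^sup>1\<close> lie in its domain.\<close>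

definition admissible :: "('g, 'e, 's) dpath \<Rightarrow> bool" where
  "admissible \<gamma> \<longleftrightarrow> (\<forall>k<N.
     inv\<^bsub>G\<^esub> (node_g \<gamma> k) \<otimes>\<^bsub>G\<^esub> node_g \<gamma> (k + 1) \<in> \<tau> ` U \<and>
     (\<forall>i. inv\<^bsub>G\<^esub> (node_g \<gamma> k) \<otimes>\<^bsub>G\<^esub> st_g \<gamma> k i \<in> \<tau> ` U))"

text \<open>A tangent vector \<open>\<delta>\<close> at \<open>\<gamma>\<close> is a path with values of \<open>'g\<close> replaced by left-trivialised
  variations in \<open>'e\<close>; \<open>vary \<gamma> \<delta>\<close> is a curve of paths with velocity \<open>\<delta>\<close> at \<open>\<epsilon> = 0\<close>. Indices outside the
  ranges of \<^const>\<open>path_space\<close> do not influence \<^term>\<open>action\<close>.\<close>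

definition vary :: "('g, 'e, 's) dpath \<Rightarrow> ('e, 'e, 's) dpath \<Rightarrow> real \<Rightarrow> ('g, 'e, 's) dpath" where
  "vary \<gamma> \<delta> \<epsilon> = \<lparr>
     node_g = (\<lambda>k. node_g \<gamma> k \<otimes>\<^bsub>G\<^esub> point G \<kappa> (\<epsilon> *\<^sub>R node_g \<delta> k)),
     node_xi = (\<lambda>k. node_xi \<gamma> k + \<epsilon> *\<^sub>R node_xi \<delta> k),
     node_cmu = (\<lambda>k. node_cmu \<gamma> k + \<epsilon> *\<^sub>R node_cmu \<delta> k),
     node_nu = (\<lambda>k. node_nu \<gamma> k + \<epsilon> *\<^sub>R node_nu \<delta> k),
     st_g = (\<lambda>k i. st_g \<gamma> k i \<otimes>\<^bsub>G\<^esub> point G \<kappa> (\<epsilon> *\<^sub>R st_g \<delta> k i)),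
     st_xi = (\<lambda>k i. st_xi \<gamma> k i + \<epsilon> *\<^sub>R st_xi \<delta> k i),
     st_v = (\<lambda>k i. st_v \<gamma> k i + \<epsilon> *\<^sub>R st_v \<delta> k i),
     st_mu = (\<lambda>k i. st_mu \<gamma> k i + \<epsilon> *\<^sub>R st_mu \<delta> k i),
     st_nu = (\<lambda>k i. st_nu \<gamma> k i + \<epsilon> *\<^sub>R st_nu \<delta> k i)\<rparr>"

definition solution :: "('g, 'e, 's) dpath \<Rightarrow> bool" where
  "solution \<gamma> \<longleftrightarrow> \<gamma> \<in> path_space N \<and> admissible \<gamma> \<and>
     (\<forall>\<delta>. node_g \<delta> 0 = 0 \<and> node_g \<delta> N = 0 \<and> node_xi \<delta> 0 = 0 \<and> node_xi \<delta> N = 0 \<longrightarrow>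
          ((\<lambda>\<epsilon>. action (vary \<gamma> \<delta> \<epsilon>)) has_real_derivative 0) (at 0))"

definition Xi_node :: "('g, 'e, 's) dpath \<Rightarrow> nat \<Rightarrow> 'e" where
  "Xi_node \<gamma> k = (\<Sum>j\<in>UNIV. b j *\<^sub>R st_xi \<gamma> (k - 1) j)"

definition Theta :: "('g, 'e, 's) dpath \<Rightarrow> nat \<Rightarrow> 's \<Rightarrow> 'e" where
  "Theta \<gamma> k i = (\<Sum>j\<in>UNIV. a i j *\<^sub>R st_xi \<gamma> k j)"

text \<open>Elements \<open>(g, \<xi>, \<mu>, \<nu>)\<close> of the left-trivialised \<open>T\<^sup>*(TG)\<close>: the initial condition of a path,
  and its value at node \<open>k \<ge> 1\<close>.\<close>

definition initial_cond :: "('g, 'e, 's) dpath \<Rightarrow> 'g \<times> 'e \<times> 'e dual \<times> 'e dual" where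
  "initial_cond \<gamma> =
     (node_g \<gamma> 0, node_xi \<gamma> 0,
      dual_map (dtau_inv G \<kappa> \<tau> (h *\<^sub>R Xi_node \<gamma> 1)) (node_cmu \<gamma> 1)
        + (\<Sum>i\<in>UNIV. dual_map (dtau_inv G \<kappa> \<tau> (h *\<^sub>R Theta \<gamma> 0 i)) (st_mu \<gamma> 0 i)),
      node_nu \<gamma> 1 + (\<Sum>i\<in>UNIV. st_nu \<gamma> 0 i))"

definition node :: "('g, 'e, 's) dpath \<Rightarrow> nat \<Rightarrow> 'g \<times> 'e \<times> 'e dual \<times> 'e dual" where
  "node \<gamma> k =
     (node_g \<gamma> k, node_xi \<gamma> k,
      dual_map (dtau_inv G \<kappa> \<tau> (- h *\<^sub>R Xi_node \<gamma> k)) (node_cmu \<gamma> k),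
      node_nu \<gamma> k)"

definition TTG_atlas ::
  "('g \<times> 'e \<times> 'e dual \<times> 'e dual, 'e \<times> 'e \<times> 'e dual \<times> 'e dual) chart set" where
  "TTG_atlas = prod_atlas A (prod_atlas vec_atlas (prod_atlas vec_atlas vec_atlas))"

definition smooth_path_family ::
  "('g \<times> 'e \<times> 'e dual \<times> 'e dual \<Rightarrow> ('g, 'e, 's) dpath) \<Rightarrow> bool" where
  "smooth_path_family \<Gamma> \<longleftrightarrow>
     (\<forall>k\<in>{0..N}.
        manifold_map smooth_on TTG_atlas A UNIV (\<lambda>z. node_g (\<Gamma> z) k) \<and>
        manifold_map smooth_on TTG_atlas vec_atlas UNIV (\<lambda>z. node_xi (\<Gamma> z) k)) \<and>
     (\<forall>k\<in>{1..N}.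
        manifold_map smooth_on TTG_atlas vec_atlas UNIV (\<lambda>z. node_cmu (\<Gamma> z) k) \<and>
        manifold_map smooth_on TTG_atlas vec_atlas UNIV (\<lambda>z. node_nu (\<Gamma> z) k)) \<and>
     (\<forall>k<N. \<forall>i.
        manifold_map smooth_on TTG_atlas A UNIV (\<lambda>z. st_g (\<Gamma> z) k i) \<and>
        manifold_map smooth_on TTG_atlas vec_atlas UNIV (\<lambda>z. st_xi (\<Gamma> z) k i) \<and>
        manifold_map smooth_on TTG_atlas vec_atlas UNIV (\<lambda>z. st_v (\<Gamma> z) k i) \<and>
        manifold_map smooth_on TTG_atlas vec_atlas UNIV (\<lambda>z. st_mu (\<Gamma> z) k i) \<and>
        manifold_map smooth_on TTG_atlas vec_atlas UNIV (\<lambda>z. st_nu (\<Gamma> z) k i))"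

definition eliminable :: bool where
  "eliminable \<longleftrightarrow>
     (\<forall>z. \<exists>!\<gamma>. solution \<gamma> \<and> initial_cond \<gamma> = z) \<and>
     smooth_path_family (\<lambda>z. THE \<gamma>. solution \<gamma> \<and> initial_cond \<gamma> = z)"

definition discrete_flow ::
  "('g \<times> 'e \<times> 'e dual \<times> 'e dual \<Rightarrow> 'g \<times> 'e \<times> 'e dual \<times> 'e dual) \<Rightarrow> bool" where
  "discrete_flow F \<longleftrightarrow>
     manifold_map smooth_on TTG_atlas TTG_atlas UNIV F \<and>
     (\<forall>\<gamma>. solution \<gamma> \<longrightarrow> (\<forall>k\<in>{1..N}. (F ^^ k) (initial_cond \<gamma>) = node \<gamma> k))"

section \<open>The symplectic form\<close>

definition omega ::
  "'g \<times> 'e \<times> 'e dual \<times> 'e dual \<Rightarrow>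
   'e \<times> 'e \<times> 'e dual \<times> 'e dual \<Rightarrow> 'e \<times> 'e \<times> 'e dual \<times> 'e dual \<Rightarrow> real" where
  "omega = (\<lambda>(g, \<xi>, \<mu>, \<nu>) (\<eta>1, \<delta>\<xi>1, \<delta>\<mu>1, \<delta>\<nu>1) (\<eta>2, \<delta>\<xi>2, \<delta>\<mu>2, \<delta>\<nu>2).
     - blinfun_apply \<delta>\<mu>1 \<eta>2 - blinfun_apply \<delta>\<nu>1 \<delta>\<xi>2
     + blinfun_apply \<delta>\<mu>2 \<eta>1 + blinfun_apply \<delta>\<nu>2 \<delta>\<xi>1
     + blinfun_apply \<mu> (lie_bracket G \<kappa> \<eta>1 \<eta>2))"

text \<open>\<open>TTG_diff z\<close> is the chart of \<open>T\<^sup>*(TG)\<close> around \<open>z\<close> obtained from \<open>\<kappa>\<close> by left translation, so its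
  differential at \<open>z\<close> is the left trivialisation; \<open>TTG_point z\<close> is its local inverse.\<close>

definition TTG_point ::
  "'g \<times> 'e \<times> 'e dual \<times> 'e dual \<Rightarrow> 'e \<times> 'e \<times> 'e dual \<times> 'e dual \<Rightarrow> 'g \<times> 'e \<times> 'e dual \<times> 'e dual" where
  "TTG_point = (\<lambda>(g, \<xi>, \<mu>, \<nu>) (\<eta>, \<delta>\<xi>, \<delta>\<mu>, \<delta>\<nu>).
     (g \<otimes>\<^bsub>G\<^esub> point G \<kappa> \<eta>, \<xi> + \<delta>\<xi>, \<mu> + \<delta>\<mu>, \<nu> + \<delta>\<nu>))"

definition TTG_diff ::
  "'g \<times> 'e \<times> 'e dual \<times> 'e dual \<Rightarrow> 'g \<times> 'e \<times> 'e dual \<times> 'e dual \<Rightarrow> 'e \<times> 'e \<times> 'e dual \<times> 'e dual" where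
  "TTG_diff = (\<lambda>(g, \<xi>, \<mu>, \<nu>) (g', \<xi>', \<mu>', \<nu>').
     (coord G \<kappa> (inv\<^bsub>G\<^esub> g \<otimes>\<^bsub>G\<^esub> g'), \<xi>' - \<xi>, \<mu>' - \<mu>, \<nu>' - \<nu>))"

definition tangent_map ::
  "('g \<times> 'e \<times> 'e dual \<times> 'e dual \<Rightarrow> 'g \<times> 'e \<times> 'e dual \<times> 'e dual) \<Rightarrow>
   'g \<times> 'e \<times> 'e dual \<times> 'e dual \<Rightarrow> 'e \<times> 'e \<times> 'e dual \<times> 'e dual \<Rightarrow> 'e \<times> 'e \<times> 'e dual \<times> 'e dual" where
  "tangent_map F z v = frechet_derivative (\<lambda>w. TTG_diff (F z) (F (TTG_point z w))) (at 0) v"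

definition pullback ::
  "('g \<times> 'e \<times> 'e dual \<times> 'e dual \<Rightarrow> 'g \<times> 'e \<times> 'e dual \<times> 'e dual) \<Rightarrow>
   ('g \<times> 'e \<times> 'e dual \<times> 'e dual \<Rightarrow>
     'e \<times> 'e \<times> 'e dual \<times> 'e dual \<Rightarrow> 'e \<times> 'e \<times> 'e dual \<times> 'e dual \<Rightarrow> real) \<Rightarrow>
   'g \<times> 'e \<times> 'e dual \<times> 'e dual \<Rightarrow>
     'e \<times> 'e \<times> 'e dual \<times> 'e dual \<Rightarrow> 'e \<times> 'e \<times> 'e dual \<times> 'e dual \<Rightarrow> real" where
  "pullback F \<Omega> z v1 v2 = \<Omega> (F z) (tangent_map F z v1) (tangent_map F z v2)"

end

end

theory Submission
  imports Defs
begin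

text \<open>On solutions the constraints hold, so the first summand of the functional reduces to
  \<open>S = h \<Sum>\<^sub>i b\<^sub>i \<ell>(\<Xi>\<^sub>0\<^sup>i, V\<^sub>0\<^sup>i)\<close>, a function of the initial condition alone. The stationarity equations
  in the internal variables of that step turn its differential into
  \<open>dS(v) = \<langle>\<mu>\<^sub>1, g\<^sub>1\<^sup>-\<^sup>1\<delta>g\<^sub>1\<rangle> + \<langle>\<nu>\<^sub>1, \<delta>\<xi>\<^sub>1\<rangle> - \<langle>\<mu>\<^sub>0, g\<^sub>0\<^sup>-\<^sup>1\<delta>g\<^sub>0\<rangle> - \<langle>\<nu>\<^sub>0, \<delta>\<xi>\<^sub>0\<rangle>\<close>, i.e. \<open>dS = F\<^sup>*\<theta> - \<theta>\<close> for the
  canonical one-form \<open>\<theta>\<close>. Since \<open>\<omega> = - d\<theta>\<close>, symplecticity of \<open>F\<close> is \<open>d(dS) = 0\<close>. In a fixed chart this is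
  the symmetry of the second derivative of \<open>S\<close>; the bracket term of \<open>\<omega>\<close> comes from the derivative of the
  Maurer--Cartan form at the unit.\<close>

section \<open>Twice differentiable maps\<close>

text \<open>The group is a bare type with an atlas, so there is no tangent bundle in which to
  differentiate. Every map is pulled back along \<open>TTG_point G \<kappa> z\<close> to a vector
  space and studied near 0. Left trivialisation is not constant there: at a point w near 0 it
  differs from the coordinate differential by \<open>maurer_cartan\<close>, and this factor must
  stay in dS until the second derivative has been taken.

  One step suffices because \<open>F z\<close> is node 1 of the solution starting at z. On solutions
  the stage momenta vanish, d\<tau>^-1 being onto, so the sum over the stages disappears from the
  initial momentum. What is left of the initial and final momenta are two transports of one
  multiplier, by d\<tau>^-1 at h \<Xi>_1 and at -h \<Xi>_1: these are, up to sign, the two partial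
  differentials of \<tau>^-1(g_0^-1 g_1).

  The derivative of S near 0 rests on the smoothness of the stages, but its second derivative is
  read off from the boundary terms, where positions are differentiated twice and momenta
  once.\<close>

lemma has_derivative_cong_nhds:
  assumes "\<forall>\<^sub>F y in nhds x. f y = g y"
  shows "(f has_derivative D) (at x) \<longleftrightarrow> (g has_derivative D) (at x)"
proof -
  have *: "(k has_derivative D) (at x)"
    if "(j has_derivative D) (at x)" "\<forall>\<^sub>F y in nhds x. j y = k y" for j k
    using has_derivative_transform_eventually[OF that(1)] that(2) eventually_nhds_x_imp_x[OF that(2)]
    by (simp add: eventually_nhds_conv_at)
  show ?thesis
    using *[of f g] *[of g f] assms by (auto simp: eq_commute[of "g _"])
qed

lemma has_derivative_unique_nhds:
  assumes "(f has_derivative D) (at x)" "(g has_derivative E) (at x)" "\<forall>\<^sub>F y in nhds x. f y = g y"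
  shows "D = E"
  using assms(1,2) unfolding has_derivative_cong_nhds[OF assms(3)] by (rule has_derivative_unique)

lemma has_derivative_compose_eq:
  assumes "(f has_derivative f') (at x)" "f x = y" "(g has_derivative g') (at y)"
  shows "((\<lambda>x. g (f x)) has_derivative (\<lambda>v. g' (f' v))) (at x)"
  using has_derivative_compose[OF assms(1)] assms(2,3) by blast

lemma eventually_nhds_compose:
  assumes "isCont f x" "\<forall>\<^sub>F z in nhds (f x). P z"
  shows "\<forall>\<^sub>F y in nhds x. P (f y)"
  using eventually_compose_filterlim[OF assms(2)] assms(1)
  by (simp add: isCont_def tendsto_at_iff_tendsto_nhds)

text \<open>Product rule for a linear map applied to a moving vector, when the map is known to be
  differentiable only after evaluation at each fixed vector. Finite dimension makes this enough:
  over the basis, \<open>K y (u y)\<close> is a finite sum of scalars times vectors.\<close>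

lemma has_derivative_family_apply:
  fixes K :: "'a::real_normed_vector \<Rightarrow> 'b::euclidean_space \<Rightarrow> 'c::real_normed_vector"
  assumes K: "\<And>v. ((\<lambda>y. K y v) has_derivative (\<lambda>k. K' k v)) (at x)"
    and lin: "\<forall>\<^sub>F y in nhds x. linear (K y)"
    and u: "(u has_derivative u') (at x)"
  shows "((\<lambda>y. K y (u y)) has_derivative (\<lambda>k. K' k (u x) + K x (u' k))) (at x)"
proof -
  have expand: "K y v = (\<Sum>i\<in>Basis. (v \<bullet> i) *\<^sub>R K y i)" if "linear (K y)" for y v
    using linear_sum[OF that, of "\<lambda>i. (v \<bullet> i) *\<^sub>R i" Basis]
    by (simp add: euclidean_representation linear_cmul[OF that])
  have ev: "\<forall>\<^sub>F y in nhds x. K y (w y) = (\<Sum>i\<in>Basis. (w y \<bullet> i) *\<^sub>R K y i)" for w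
    using lin by eventually_elim (rule expand)
  \<comment> \<open>Linearity of \<open>K'\<close> in its second argument is not assumed; uniqueness
    of derivatives forces the basis expansion on it.\<close>
  have K': "(\<lambda>k. K' k v) = (\<lambda>k. \<Sum>i\<in>Basis. (v \<bullet> i) *\<^sub>R K' k i)" for v
    by (rule has_derivative_unique_nhds[OF K _ ev]) (auto intro!: derivative_eq_intros K)
  have "((\<lambda>y. \<Sum>i\<in>Basis. (u y \<bullet> i) *\<^sub>R K y i) has_derivative
      (\<lambda>k. \<Sum>i\<in>Basis. (u x \<bullet> i) *\<^sub>R K' k i + (u' k \<bullet> i) *\<^sub>R K x i)) (at x)"
    by (auto intro!: derivative_eq_intros K u)
  also have "(\<lambda>k. \<Sum>i\<in>Basis. (u x \<bullet> i) *\<^sub>R K' k i + (u' k \<bullet> i) *\<^sub>R K x i) =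
      (\<lambda>k. K' k (u x) + K x (u' k))"
  proof
    fix k
    have "K' k (u x) = (\<Sum>i\<in>Basis. (u x \<bullet> i) *\<^sub>R K' k i)"
      using K'[of "u x"] by (rule fun_cong)
    then show "(\<Sum>i\<in>Basis. (u x \<bullet> i) *\<^sub>R K' k i + (u' k \<bullet> i) *\<^sub>R K x i) = K' k (u x) + K x (u' k)"
      using expand[OF eventually_nhds_x_imp_x[OF lin], of "u' k"] by (simp only: sum.distrib)
  qed
  finally show ?thesis
    by (subst has_derivative_cong_nhds[OF ev])
qed

text \<open>Directionwise, as in \<open>Ck_on\<close>: \<open>\<lambda>y. f' y v\<close> is
  differentiated for each fixed v, so no norm on a space of operators is involved. In
  \<open>f'' k v\<close> the first argument is the direction of the second differentiation. The
  first derivative exists near x, the second is asked for at x alone.\<close>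

definition has_second_derivative ::
  "('a::real_normed_vector \<Rightarrow> 'b::real_normed_vector) \<Rightarrow> ('a \<Rightarrow> 'a \<Rightarrow> 'b) \<Rightarrow> ('a \<Rightarrow> 'a \<Rightarrow> 'b) \<Rightarrow> 'a \<Rightarrow> bool"
  where "has_second_derivative f f' f'' x \<longleftrightarrow>
    (\<forall>\<^sub>F y in nhds x. (f has_derivative f' y) (at y)) \<and>
    (\<forall>v. ((\<lambda>y. f' y v) has_derivative (\<lambda>k. f'' k v)) (at x))"

definition twice_differentiable_at ::
  "('a::real_normed_vector \<Rightarrow> 'b::real_normed_vector) \<Rightarrow> 'a \<Rightarrow> bool"
  where "twice_differentiable_at f x \<longleftrightarrow> (\<exists>f' f''. has_second_derivative f f' f'' x)"

lemma twice_differentiable_atI: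
  assumes "\<forall>\<^sub>F y in nhds x. (f has_derivative f' y) (at y)"
    and "\<And>v. \<exists>D. ((\<lambda>y. f' y v) has_derivative D) (at x)"
  shows "twice_differentiable_at f x"
proof -
  obtain D where "\<And>v. ((\<lambda>y. f' y v) has_derivative D v) (at x)"
    using assms(2) by metis
  then have "has_second_derivative f f' (\<lambda>k v. D v k) x"
    using assms(1) by (auto simp: has_second_derivative_def)
  then show ?thesis
    by (auto simp: twice_differentiable_at_def)
qed

lemma twice_differentiable_atE:
  assumes "twice_differentiable_at f x"
  obtains f' f'' where "\<forall>\<^sub>F y in nhds x. (f has_derivative f' y) (at y)"
    and "\<And>v. ((\<lambda>y. f' y v) has_derivative (\<lambda>k. f'' k v)) (at x)"
  using assms by (auto simp: twice_differentiable_at_def has_second_derivative_def)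

lemma twice_differentiable_imp_differentiable:
  "twice_differentiable_at f x \<Longrightarrow> f differentiable at x"
  by (erule twice_differentiable_atE) (auto dest: eventually_nhds_x_imp_x intro: differentiableI)

lemma twice_differentiable_imp_isCont: "twice_differentiable_at f x \<Longrightarrow> isCont f x"
  by (simp add: differentiable_imp_continuous_within twice_differentiable_imp_differentiable)

lemma twice_differentiable_imp_eventually_differentiable:
  "twice_differentiable_at f x \<Longrightarrow> \<forall>\<^sub>F y in nhds x. f differentiable at y"
  by (auto elim!: twice_differentiable_atE eventually_mono simp: differentiable_def)

lemma twice_differentiable_cong_nhds:
  assumes "twice_differentiable_at f x" "\<forall>\<^sub>F y in nhds x. f y = g y"
  shows "twice_differentiable_at g x"
proof (rule twice_differentiable_atE[OF assms(1)])
  fix f' f''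
  assume f': "\<forall>\<^sub>F y in nhds x. (f has_derivative f' y) (at y)"
    and f'': "\<And>v. ((\<lambda>y. f' y v) has_derivative (\<lambda>k. f'' k v)) (at x)"
  have "\<forall>\<^sub>F y in nhds x. \<forall>\<^sub>F z in nhds y. f z = g z"
    using assms(2) by (simp add: eventually_eventually)
  with f' have "\<forall>\<^sub>F y in nhds x. (g has_derivative f' y) (at y)"
    by eventually_elim (simp add: has_derivative_cong_nhds)
  then show ?thesis
    using f'' by (auto intro!: twice_differentiable_atI)
qed

lemma smooth_on_imp_twice_differentiable:
  assumes "smooth_on S f" "open S" "x \<in> S"
  shows "twice_differentiable_at f x"
proof (rule twice_differentiable_atI)
  have Ck: "Ck_on (Suc (Suc 0)) S f"
    using assms by (simp add: smooth_on_def)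
  then show "\<forall>\<^sub>F y in nhds x. (f has_derivative frechet_derivative f (at y)) (at y)"
    using eventually_nhds_in_open[OF assms(2,3)]
    by (auto elim!: eventually_mono simp: frechet_derivative_works)
  show "\<exists>D. ((\<lambda>y. frechet_derivative f (at y) v) has_derivative D) (at x)" for v
    using Ck assms(3) by (auto simp: differentiable_def)
qed

section \<open>Calculus of twice differentiable maps\<close>

lemma twice_differentiable_const: "twice_differentiable_at (\<lambda>y. c) x"
  by (rule twice_differentiable_atI[where f' = "\<lambda>y k. 0"]) (auto intro: exI[of _ "\<lambda>k. 0"])

lemma twice_differentiable_linear_compose:
  assumes "bounded_linear T" "twice_differentiable_at f x"
  shows "twice_differentiable_at (\<lambda>y. T (f y)) x"
proof (rule twice_differentiable_atE[OF assms(2)])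
  fix f' f''
  assume f': "\<forall>\<^sub>F y in nhds x. (f has_derivative f' y) (at y)"
    and f'': "\<And>v. ((\<lambda>y. f' y v) has_derivative (\<lambda>k. f'' k v)) (at x)"
  have "\<forall>\<^sub>F y in nhds x. ((\<lambda>y. T (f y)) has_derivative (\<lambda>v. T (f' y v))) (at y)"
    using f' by eventually_elim (rule bounded_linear.has_derivative[OF assms(1)])
  then show ?thesis
    using bounded_linear.has_derivative[OF assms(1) f''] by (auto intro!: twice_differentiable_atI)
qed

lemma twice_differentiable_Pair:
  assumes "twice_differentiable_at f x" "twice_differentiable_at g x"
  shows "twice_differentiable_at (\<lambda>y. (f y, g y)) x"
proof (rule twice_differentiable_atE[OF assms(1)], rule twice_differentiable_atE[OF assms(2)])
  fix f' f'' g' g''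
  assume f': "\<forall>\<^sub>F y in nhds x. (f has_derivative f' y) (at y)"
    and f'': "\<And>v. ((\<lambda>y. f' y v) has_derivative (\<lambda>k. f'' k v)) (at x)"
    and g': "\<forall>\<^sub>F y in nhds x. (g has_derivative g' y) (at y)"
    and g'': "\<And>v. ((\<lambda>y. g' y v) has_derivative (\<lambda>k. g'' k v)) (at x)"
  have "\<forall>\<^sub>F y in nhds x. ((\<lambda>y. (f y, g y)) has_derivative (\<lambda>v. (f' y v, g' y v))) (at y)"
    using f' g' by eventually_elim (rule has_derivative_Pair)
  then show ?thesis
    using has_derivative_Pair[OF f'' g''] by (auto intro!: twice_differentiable_atI)
qed

lemma twice_differentiable_affine:
  assumes "bounded_linear L"
  shows "twice_differentiable_at (\<lambda>y. L y + c) x"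
proof (rule twice_differentiable_atI[where f' = "\<lambda>y. L"])
  have "((\<lambda>y. L y + c) has_derivative L) (at y)" for y
    by (auto intro!: derivative_eq_intros bounded_linear_imp_has_derivative assms)
  then show "\<forall>\<^sub>F y in nhds x. ((\<lambda>y. L y + c) has_derivative L) (at y)"
    by simp
  show "\<exists>D. ((\<lambda>y. L v) has_derivative D) (at x)" for v
    by (rule exI) (rule has_derivative_const)
qed

lemma twice_differentiable_id: "twice_differentiable_at (\<lambda>y. y) x"
  using twice_differentiable_affine[OF bounded_linear_ident, where c = 0] by simp

lemma twice_differentiable_fst: "twice_differentiable_at f x \<Longrightarrow> twice_differentiable_at (\<lambda>y. fst (f y)) x"
  by (rule twice_differentiable_linear_compose[OF bounded_linear_fst])

lemma twice_differentiable_snd: "twice_differentiable_at f x \<Longrightarrow> twice_differentiable_at (\<lambda>y. snd (f y)) x"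
  by (rule twice_differentiable_linear_compose[OF bounded_linear_snd])

lemma twice_differentiable_add:
  assumes "twice_differentiable_at f x" "twice_differentiable_at g x"
  shows "twice_differentiable_at (\<lambda>y. f y + g y) x"
  using twice_differentiable_linear_compose[OF _ twice_differentiable_Pair[OF assms],
      where T = "\<lambda>p. fst p + snd p"]
  by (simp add: bounded_linear_add bounded_linear_fst bounded_linear_snd)

text \<open>The affine component \<open>q\<close> may take values in a space, such as \<^typ>\<open>'e dual\<close>, that is not an
  instance of \<^class>\<open>euclidean_space\<close>.\<close>

lemma twice_differentiable_compose_affine:
  fixes p :: "'a::real_normed_vector \<Rightarrow> 'b::euclidean_space" and Q :: "'a \<Rightarrow> 'c::real_normed_vector"
  assumes g: "twice_differentiable_at g (p x, Q x + c)"
    and p: "twice_differentiable_at p x" and Q: "bounded_linear Q"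
  shows "twice_differentiable_at (\<lambda>y. g (p y, Q y + c)) x"
proof (rule twice_differentiable_atE[OF g], rule twice_differentiable_atE[OF p])
  let ?q = "\<lambda>y. (p y, Q y + c)"
  fix g' g'' p' p''
  assume g': "\<forall>\<^sub>F y in nhds (?q x). (g has_derivative g' y) (at y)"
    and g'': "\<And>v. ((\<lambda>y. g' y v) has_derivative (\<lambda>k. g'' k v)) (at (?q x))"
    and p': "\<forall>\<^sub>F y in nhds x. (p has_derivative p' y) (at y)"
    and p'': "\<And>v. ((\<lambda>y. p' y v) has_derivative (\<lambda>k. p'' k v)) (at x)"
  have Qd: "((\<lambda>y. Q y + c) has_derivative Q) (at y)" for y
    by (auto intro!: derivative_eq_intros bounded_linear_imp_has_derivative Q)
  have q': "\<forall>\<^sub>F y in nhds x. (?q has_derivative (\<lambda>v. (p' y v, Q v))) (at y)"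
    using p' by eventually_elim (auto intro!: has_derivative_Pair Qd)
  note qx = eventually_nhds_x_imp_x[OF q']
  have g'q: "\<forall>\<^sub>F y in nhds x. (g has_derivative g' (?q y)) (at (?q y))"
    by (rule eventually_nhds_compose[OF has_derivative_continuous[OF qx] g'])
  have 1: "\<forall>\<^sub>F y in nhds x. ((\<lambda>y. g (?q y)) has_derivative (\<lambda>v. g' (?q y) (p' y v, Q v))) (at y)"
    using q' g'q by eventually_elim (rule has_derivative_compose)
  have 2: "((\<lambda>y. g' (?q y) v) has_derivative (\<lambda>k. g'' (p' x k, Q k) v)) (at x)" for v
    by (rule has_derivative_compose[OF qx g''])
  have lin: "\<forall>\<^sub>F y in nhds x. linear (\<lambda>e. g' (?q y) (e, 0))"
    using g'q
  proof eventually_elim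
    case (elim y)
    show ?case
      using linear_compose[of "\<lambda>e. (e, 0)" "g' (?q y)"] has_derivative_linear[OF elim]
      by (simp add: o_def linear_iff)
  qed
  \<comment> \<open>The direction \<open>(p' y v, Q v)\<close> itself moves with y. Its moving part
    lies in the Euclidean factor, where the product rule applies; its part in the other factor is
    constant, so \<open>2\<close> is enough for it.\<close>
  have 3: "((\<lambda>y. g' (?q y) (p' y v, 0) + g' (?q y) (0, Q v)) has_derivative
      (\<lambda>k. (g'' (p' x k, Q k) (p' x v, 0) + g' (?q x) (p'' k v, 0)) + g'' (p' x k, Q k) (0, Q v))) (at x)" for v
    by (rule has_derivative_add[OF has_derivative_family_apply[OF 2 lin p''] 2])
  have 4: "\<forall>\<^sub>F y in nhds x. g' (?q y) (p' y v, 0) + g' (?q y) (0, Q v) = g' (?q y) (p' y v, Q v)" for v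
    using g'q
  proof eventually_elim
    case (elim y)
    show ?case
      using linear_add[OF has_derivative_linear[OF elim], of "(p' y v, 0)" "(0, Q v)"] by simp
  qed
  show ?thesis
    using 1 3[unfolded has_derivative_cong_nhds[OF 4]] by (rule twice_differentiable_atI[OF _ exI])
qed

text \<open>A dummy real factor, constantly 0, reduces this to the version with an affine
  component.\<close>

lemma twice_differentiable_compose:
  fixes p :: "'a::real_normed_vector \<Rightarrow> 'b::euclidean_space"
  assumes "twice_differentiable_at g (p x)" "twice_differentiable_at p x"
  shows "twice_differentiable_at (\<lambda>y. g (p y)) x"
proof -
  have "twice_differentiable_at (\<lambda>z::'b \<times> real. g (fst z)) (p x, 0)"
  proof (rule twice_differentiable_atE[OF assms(1)])
    fix g' g''
    assume g': "\<forall>\<^sub>F y in nhds (p x). (g has_derivative g' y) (at y)"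
      and g'': "\<And>v. ((\<lambda>y. g' y v) has_derivative (\<lambda>k. g'' k v)) (at (p x))"
    have fst': "(fst has_derivative fst) (at z)" for z :: "'b \<times> real"
      by (rule bounded_linear_imp_has_derivative[OF bounded_linear_fst])
    have "isCont (fst :: 'b \<times> real \<Rightarrow> 'b) (p x, 0)"
      by (rule has_derivative_continuous[OF fst'])
    then have "\<forall>\<^sub>F z in nhds (p x, 0::real). (g has_derivative g' (fst z)) (at (fst z))"
      by (rule eventually_nhds_compose) (simp add: g')
    then have "\<forall>\<^sub>F z in nhds (p x, 0::real). ((\<lambda>z. g (fst z)) has_derivative (\<lambda>v. g' (fst z) (fst v))) (at z)"
      by eventually_elim (rule has_derivative_compose[OF fst'])
    moreover have "((\<lambda>z. g' (fst z) v) has_derivative (\<lambda>k. g'' (fst k) v)) (at (p x, 0::real))" for v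
      by (rule has_derivative_compose[OF fst']) (simp add: g'')
    ultimately show ?thesis
      by (rule twice_differentiable_atI[OF _ exI])
  qed
  then have "twice_differentiable_at (\<lambda>z::'b \<times> real. g (fst z)) (p x, (\<lambda>_. 0) x + 0)"
    by simp
  from twice_differentiable_compose_affine[OF this assms(2) bounded_linear_zero] show ?thesis
    by simp
qed

subsection \<open>Symmetry of the second derivative\<close>

text \<open>The mean value theorem along u turns the second difference into t times an increment of
  \<open>\<lambda>y. f' y u\<close>, and differentiability of that one map at x evaluates the
  increment. Continuity of second derivatives is not assumed.\<close>

lemma second_difference_estimate:
  fixes f :: "'a::real_normed_vector \<Rightarrow> real"
  assumes D: "\<forall>\<^sub>F y in nhds x. (f has_derivative f' y) (at y)"
    and D2: "((\<lambda>y. f' y u) has_derivative B) (at x)" and "e > 0"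
  shows "\<exists>d>0. \<forall>t. 0 < t \<and> t < d \<longrightarrow>
    \<bar>f (x + t *\<^sub>R u + t *\<^sub>R v) - f (x + t *\<^sub>R u) - f (x + t *\<^sub>R v) + f x - t\<^sup>2 * B v\<bar> \<le> e * t\<^sup>2"
proof -
  \<comment> \<open>All points that occur lie within \<open>t * M\<close> of x; the summand 1 keeps
    M positive.\<close>
  define M where "M = norm u + norm v + 1"
  have M: "M > 0" "norm u \<le> M" by (auto simp: M_def add_pos_nonneg add_nonneg_pos)
  \<comment> \<open>Two errors of size \<open>e' * (t * M)\<close> have to add up to
    \<open>e * t\<close>.\<close>
  define e' where "e' = e / (2 * M)"
  have e': "e' > 0" using M assms by (simp add: e'_def)
  interpret B: bounded_linear B using D2 by (rule has_derivative_bounded_linear)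
  obtain d1 where d1: "d1 > 0" and
    est: "\<And>y. norm (y - x) < d1 \<Longrightarrow> \<bar>f' y u - f' x u - B (y - x)\<bar> \<le> e' * norm (y - x)"
    using D2 e' unfolding has_derivative_at_alt by (metis real_norm_def)
  obtain d2 where d2: "d2 > 0" and f: "\<And>y. norm (y - x) < d2 \<Longrightarrow> (f has_derivative f' y) (at y)"
    using D unfolding eventually_nhds_metric dist_norm by blast
  define d where "d = min d1 d2 / M"
  show ?thesis
  proof (intro exI[of _ d] conjI allI impI)
    show "d > 0" using d1 d2 M by (simp add: d_def)
    fix t :: real assume t: "0 < t \<and> t < d"
    then have tM: "t * M < d1" "t * M < d2"
      using M by (auto simp: d_def pos_less_divide_eq)
    have bound: "norm (s *\<^sub>R u + r *\<^sub>R v) \<le> t * M" if "0 \<le> s" "s \<le> t" "0 \<le> r" "r \<le> t" for s r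
    proof -
      have "norm (s *\<^sub>R u + r *\<^sub>R v) \<le> s * norm u + r * norm v"
        using norm_triangle_ineq[of "s *\<^sub>R u" "r *\<^sub>R v"] that by simp
      also have "\<dots> \<le> t * norm u + t * norm v"
        using that by (intro add_mono mult_right_mono) auto
      also have "\<dots> \<le> t * M" using t by (simp add: M_def algebra_simps)
      finally show ?thesis .
    qed
    \<comment> \<open>The second difference is \<open>\<phi> t - \<phi> 0\<close>.\<close>
    define \<phi> where "\<phi> s = f (x + s *\<^sub>R u + t *\<^sub>R v) - f (x + s *\<^sub>R u)" for s
    have \<phi>': "(\<phi> has_real_derivative f' (x + s *\<^sub>R u + t *\<^sub>R v) u - f' (x + s *\<^sub>R u) u) (at s)"
      if "0 \<le> s" "s \<le> t" for s
    proof -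
      have "(f has_derivative f' (x + s *\<^sub>R u + t *\<^sub>R v)) (at (x + s *\<^sub>R u + t *\<^sub>R v))"
        "(f has_derivative f' (x + s *\<^sub>R u)) (at (x + s *\<^sub>R u))"
        using bound[OF that, of t] bound[OF that, of 0] tM t by (auto intro!: f simp: add.assoc)
      note dd = this
      have "((\<lambda>s. f (x + s *\<^sub>R u + t *\<^sub>R v)) has_derivative (\<lambda>k. f' (x + s *\<^sub>R u + t *\<^sub>R v) (k *\<^sub>R u))) (at s)"
        "((\<lambda>s. f (x + s *\<^sub>R u)) has_derivative (\<lambda>k. f' (x + s *\<^sub>R u) (k *\<^sub>R u))) (at s)"
        by (rule has_derivative_compose[where f = "\<lambda>s. x + s *\<^sub>R u + t *\<^sub>R v", OF _ dd(1)]
              has_derivative_compose[where f = "\<lambda>s. x + s *\<^sub>R u", OF _ dd(2)],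
            auto intro!: derivative_eq_intros)+
      from has_derivative_diff[OF this] show ?thesis
        unfolding \<phi>_def has_field_derivative_def
        by (rule has_derivative_eq_rhs)
          (auto simp: linear_cmul[OF has_derivative_linear[OF dd(1)]]
            linear_cmul[OF has_derivative_linear[OF dd(2)]] fun_eq_iff right_diff_distrib mult.commute)
    qed
    obtain \<theta> where \<theta>: "0 < \<theta>" "\<theta> < t"
      and mvt: "\<phi> t - \<phi> 0 = (t - 0) * (f' (x + \<theta> *\<^sub>R u + t *\<^sub>R v) u - f' (x + \<theta> *\<^sub>R u) u)"
      using MVT2[of 0 t \<phi> "\<lambda>s. f' (x + s *\<^sub>R u + t *\<^sub>R v) u - f' (x + s *\<^sub>R u) u"] \<phi>' t by auto
    have *: "\<bar>f' (x + w) u - f' x u - B w\<bar> \<le> e' * (t * M)" if "norm w \<le> t * M" for w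
    proof -
      have "\<bar>f' (x + w) u - f' x u - B w\<bar> \<le> e' * norm w"
        using est[of "x + w"] that tM by simp
      also have "\<dots> \<le> e' * (t * M)"
        using that e' by (intro mult_left_mono) auto
      finally show ?thesis .
    qed
    have b1: "\<bar>f' (x + \<theta> *\<^sub>R u + t *\<^sub>R v) u - f' x u - B (\<theta> *\<^sub>R u + t *\<^sub>R v)\<bar> \<le> e' * (t * M)"
      using *[OF bound[of \<theta> t]] \<theta> t by (simp add: add.assoc)
    have b2: "\<bar>f' (x + \<theta> *\<^sub>R u) u - f' x u - B (\<theta> *\<^sub>R u)\<bar> \<le> e' * (t * M)"
      using *[OF bound[of \<theta> 0]] \<theta> t by simp
    have "\<bar>(f' (x + \<theta> *\<^sub>R u + t *\<^sub>R v) u - f' (x + \<theta> *\<^sub>R u) u) - t * B v\<bar> \<le> 2 * (e' * (t * M))"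
      using b1 b2 by (simp add: B.add B.scaleR)
    also have "2 * (e' * (t * M)) = e * t"
      using M by (simp add: e'_def)
    finally have le: "t * \<bar>(f' (x + \<theta> *\<^sub>R u + t *\<^sub>R v) u - f' (x + \<theta> *\<^sub>R u) u) - t * B v\<bar> \<le> t * (e * t)"
      using t by (intro mult_left_mono) auto
    have eq: "f (x + t *\<^sub>R u + t *\<^sub>R v) - f (x + t *\<^sub>R u) - f (x + t *\<^sub>R v) + f x - t\<^sup>2 * B v
        = t * ((f' (x + \<theta> *\<^sub>R u + t *\<^sub>R v) u - f' (x + \<theta> *\<^sub>R u) u) - t * B v)"
      using mvt by (simp add: \<phi>_def algebra_simps power2_eq_square)
    have "t * (e * t) = e * t\<^sup>2" by (simp add: power2_eq_square)
    with le show "\<bar>f (x + t *\<^sub>R u + t *\<^sub>R v) - f (x + t *\<^sub>R u) - f (x + t *\<^sub>R v) + f x - t\<^sup>2 * B v\<bar> \<le> e * t\<^sup>2"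
      using t by (simp only: eq abs_mult) simp
  qed
qed

text \<open>The second difference is symmetric in u and v, while divided by t^2 it tends to either
  of the two values.\<close>

lemma second_derivative_symmetric_real:
  fixes f :: "'a::real_normed_vector \<Rightarrow> real"
  assumes "has_second_derivative f f' f'' x"
  shows "f'' u v = f'' v u"
proof (rule ccontr)
  assume neq: "f'' u v \<noteq> f'' v u"
  \<comment> \<open>The gap is then 4 e, whereas the two estimates at a common t bound it by 2
    e.\<close>
  define e where "e = \<bar>f'' u v - f'' v u\<bar> / 4"
  have e: "e > 0" using neq by (simp add: e_def)
  from assms have f: "\<forall>\<^sub>F y in nhds x. (f has_derivative f' y) (at y)"
    "\<And>v. ((\<lambda>y. f' y v) has_derivative (\<lambda>k. f'' k v)) (at x)"
    by (auto simp: has_second_derivative_def)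
  obtain d1 where d1: "d1 > 0" "\<And>t. 0 < t \<Longrightarrow> t < d1 \<Longrightarrow>
    \<bar>f (x + t *\<^sub>R u + t *\<^sub>R v) - f (x + t *\<^sub>R u) - f (x + t *\<^sub>R v) + f x - t\<^sup>2 * f'' v u\<bar> \<le> e * t\<^sup>2"
    using second_difference_estimate[OF f(1) f(2)[of u] e, of v] by blast
  obtain d2 where d2: "d2 > 0" "\<And>t. 0 < t \<Longrightarrow> t < d2 \<Longrightarrow>
    \<bar>f (x + t *\<^sub>R v + t *\<^sub>R u) - f (x + t *\<^sub>R v) - f (x + t *\<^sub>R u) + f x - t\<^sup>2 * f'' u v\<bar> \<le> e * t\<^sup>2"
    using second_difference_estimate[OF f(1) f(2)[of v] e, of u] by blast
  define t where "t = min d1 d2 / 2"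
  have t: "0 < t" "t < d1" "t < d2" using d1 d2 by (auto simp: t_def)
  have "x + t *\<^sub>R v + t *\<^sub>R u = x + t *\<^sub>R u + t *\<^sub>R v" by (simp add: algebra_simps)
  then have "\<bar>t\<^sup>2 * f'' u v - t\<^sup>2 * f'' v u\<bar> \<le> 2 * (e * t\<^sup>2)"
    using d1(2)[OF t(1,2)] d2(2)[OF t(1,3)] by (simp only: abs_le_iff) linarith
  also have "\<bar>t\<^sup>2 * f'' u v - t\<^sup>2 * f'' v u\<bar> = t\<^sup>2 * (4 * e)"
    by (simp add: e_def abs_mult flip: right_diff_distrib)
  finally show False using t e by (simp add: mult.commute)
qed

text \<open>Pairing the values with an arbitrary vector c reduces this to the real case.\<close>

lemma second_derivative_symmetric:
  fixes f :: "'a::real_normed_vector \<Rightarrow> 'b::real_inner"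
  assumes "has_second_derivative f f' f'' x"
  shows "f'' u v = f'' v u"
proof -
  have "has_second_derivative (\<lambda>y. f y \<bullet> c) (\<lambda>y v. f' y v \<bullet> c) (\<lambda>k v. f'' k v \<bullet> c) x" for c
    using assms unfolding has_second_derivative_def
    by (auto intro!: has_derivative_inner_left elim: eventually_mono)
  from second_derivative_symmetric_real[OF this] show ?thesis
    by (metis inner_commute vector_eq_ldot)
qed

section \<open>Maps into manifolds\<close>

text \<open>The part of \<open>atlas\<close> that passes easily to product atlases: charts are
  injective open maps on open sets, and they cover. Openness is what lets smoothness in charts yield
  derivatives at points.\<close>

definition open_atlas :: "('g::topological_space, 'e::real_normed_vector) chart set \<Rightarrow> bool" where
  "open_atlas A \<longleftrightarrow>
     (\<forall>(U, \<phi>)\<in>A. open U \<and> inj_on \<phi> U \<and> (\<forall>T. T \<subseteq> U \<and> open T \<longrightarrow> open (\<phi> ` T))) \<and>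
     (\<forall>g. \<exists>(U, \<phi>)\<in>A. g \<in> U)"

lemma open_atlas_chart:
  assumes "open_atlas A" "(U, \<phi>) \<in> A"
  shows "open U" "inj_on \<phi> U" "\<And>T. T \<subseteq> U \<Longrightarrow> open T \<Longrightarrow> open (\<phi> ` T)"
  using assms by (auto simp: open_atlas_def)

lemma open_atlas_cover:
  assumes "open_atlas A"
  obtains U \<phi> where "(U, \<phi>) \<in> A" "g \<in> U"
  using assms unfolding open_atlas_def by blast

lemma atlas_imp_open_atlas:
  assumes "atlas A"
  shows "open_atlas A"
  unfolding open_atlas_def
proof (intro conjI ballI allI)
  fix c assume c: "c \<in> A"
  obtain U \<phi> where [simp]: "c = (U, \<phi>)" by fastforce
  have ch: "open U" "open (\<phi> ` U)" "homeomorphism U (\<phi> ` U) \<phi> (inv_into U \<phi>)"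
    using assms c by (auto simp: atlas_def)
  have "inj_on \<phi> U"
    by (rule inj_on_inverseI[of _ "inv_into U \<phi>"]) (use ch(3) in \<open>simp add: homeomorphism_def\<close>)
  moreover have "open (\<phi> ` T)" if "T \<subseteq> U" "open T" for T
    using homeomorphism_imp_open_map[OF ch(3), of T] that ch
    by (simp add: openin_open_eq)
  ultimately show "case c of (U, \<phi>) \<Rightarrow> open U \<and> inj_on \<phi> U \<and> (\<forall>T. T \<subseteq> U \<and> open T \<longrightarrow> open (\<phi> ` T))"
    using ch by simp
next
  fix g
  have "g \<in> (\<Union>(U, \<phi>)\<in>A. U)" using assms by (simp add: atlas_def)
  then show "\<exists>(U, \<phi>)\<in>A. g \<in> U" by auto
qed

lemma open_atlas_vec: "open_atlas vec_atlas"
  by (auto simp: open_atlas_def vec_atlas_def)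

lemma open_atlas_prod:
  assumes A: "open_atlas A" and B: "open_atlas B"
  shows "open_atlas (prod_atlas A B)"
  unfolding open_atlas_def
proof (intro conjI ballI allI)
  fix c assume "c \<in> prod_atlas A B"
  then obtain U \<phi> V \<psi> where UV: "(U, \<phi>) \<in> A" "(V, \<psi>) \<in> B" and [simp]: "c = (U \<times> V, map_prod \<phi> \<psi>)"
    by (auto simp: prod_atlas_def)
  note U = open_atlas_chart[OF A UV(1)] and V = open_atlas_chart[OF B UV(2)]
  have "open (map_prod \<phi> \<psi> ` T)" if T: "T \<subseteq> U \<times> V" "open T" for T
  proof (rule open_prod_intro)
    fix y assume "y \<in> map_prod \<phi> \<psi> ` T"
    then obtain u v where uv: "(u, v) \<in> T" "y = (\<phi> u, \<psi> v)" by auto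
    obtain P Q where PQ: "open P" "open Q" "(u, v) \<in> P \<times> Q" "P \<times> Q \<subseteq> T"
      using open_prod_elim[OF T(2) uv(1)] .
    then have sub: "P \<subseteq> U" "Q \<subseteq> V" using T(1) by blast+
    show "\<exists>P Q. open P \<and> open Q \<and> y \<in> P \<times> Q \<and> P \<times> Q \<subseteq> map_prod \<phi> \<psi> ` T"
    proof (intro exI conjI)
      show "open (\<phi> ` P)" "open (\<psi> ` Q)" using U(3) V(3) sub PQ by auto
      show "y \<in> \<phi> ` P \<times> \<psi> ` Q" using PQ uv by auto
      have "\<phi> ` P \<times> \<psi> ` Q = map_prod \<phi> \<psi> ` (P \<times> Q)" by (rule map_prod_image[symmetric])
      then show "\<phi> ` P \<times> \<psi> ` Q \<subseteq> map_prod \<phi> \<psi> ` T" using PQ(4) by blast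
    qed
  qed
  then show "case c of (U, \<phi>) \<Rightarrow> open U \<and> inj_on \<phi> U \<and> (\<forall>T. T \<subseteq> U \<and> open T \<longrightarrow> open (\<phi> ` T))"
    using U V by (simp add: open_Times map_prod_inj_on)
next
  fix g :: "'a \<times> 'c"
  obtain U \<phi> V \<psi> where "(U, \<phi>) \<in> A" "fst g \<in> U" "(V, \<psi>) \<in> B" "snd g \<in> V"
    using open_atlas_cover A B by metis
  then show "\<exists>(W, \<rho>)\<in>prod_atlas A B. g \<in> W"
    by (intro bexI[of _ "(U \<times> V, map_prod \<phi> \<psi>)"]) (force simp: prod_atlas_def mem_Times_iff)+
qed

lemma prod_atlasI: "(U, \<phi>) \<in> A \<Longrightarrow> (V, \<psi>) \<in> B \<Longrightarrow> (U \<times> V, map_prod \<phi> \<psi>) \<in> prod_atlas A B"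
  by (force simp: prod_atlas_def)

lemma manifold_map_mono:
  assumes "manifold_map R A B S f" "\<And>S f. R S f \<Longrightarrow> R' S f"
  shows "manifold_map R' A B S f"
  using assms unfolding manifold_map_def by fastforce

text \<open>Continuity of f makes the set on which its chart expression is \<open>smooth_on\<close>
  the chart image of an open set, hence open, so that derivatives in a full neighbourhood are
  available.\<close>

lemma manifold_map_twice_differentiable:
  assumes f: "manifold_map smooth_on A B S f" and S: "open S" "x \<in> S"
    and A: "open_atlas A" and B: "open_atlas B"
    and U: "(U, \<phi>) \<in> A" "x \<in> U" and V: "(V, \<psi>) \<in> B" "f x \<in> V"
  shows "twice_differentiable_at (\<lambda>y. \<psi> (f (inv_into U \<phi> y))) (\<phi> x)"
proof -
  note U' = open_atlas_chart[OF A U(1)] and V' = open_atlas_chart[OF B V(1)]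
  have cont: "continuous_on S f" and sm: "smooth_on (\<phi> ` (S \<inter> U \<inter> f -` V)) (\<lambda>y. \<psi> (f (inv_into U \<phi> y)))"
    using f U(1) V(1) by (auto simp: manifold_map_def)
  have "open (S \<inter> f -` V \<inter> U)"
    by (rule open_Int[OF continuous_open_preimage[OF cont S(1) V'(1)] U'(1)])
  then have "open (\<phi> ` (S \<inter> U \<inter> f -` V))"
    by (intro U'(3)) (auto simp: Int_ac)
  then show ?thesis
    using sm S U V by (intro smooth_on_imp_twice_differentiable[OF sm]) auto
qed

text \<open>With a vector space as source, regularity propagates through the group operations by
  introduction rules and no source atlas appears. Continuity is recorded separately because
  \<open>\<psi> (f y)\<close> carries no information once \<open>f y\<close> leaves V.\<close>

definition twice_differentiable_into ::
  "('g::topological_space, 'e::real_normed_vector) chart set \<Rightarrow> ('a::real_normed_vector \<Rightarrow> 'g) \<Rightarrow> 'a \<Rightarrow> bool"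
  where "twice_differentiable_into A f x \<longleftrightarrow> isCont f x \<and>
    (\<forall>(V, \<psi>)\<in>A. f x \<in> V \<longrightarrow> twice_differentiable_at (\<lambda>y. \<psi> (f y)) x)"

lemma twice_differentiable_into_chart:
  "twice_differentiable_into A f x \<Longrightarrow> (V, \<psi>) \<in> A \<Longrightarrow> f x \<in> V \<Longrightarrow>
    twice_differentiable_at (\<lambda>y. \<psi> (f y)) x"
  by (auto simp: twice_differentiable_into_def)

lemma twice_differentiable_into_isCont: "twice_differentiable_into A f x \<Longrightarrow> isCont f x"
  by (simp add: twice_differentiable_into_def)

lemma twice_differentiable_into_const: "twice_differentiable_into A (\<lambda>y. g) x"
  by (auto simp: twice_differentiable_into_def twice_differentiable_const)

lemma twice_differentiable_into_vec:
  "twice_differentiable_into vec_atlas f x \<longleftrightarrow> twice_differentiable_at f x"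
  by (auto simp: twice_differentiable_into_def vec_atlas_def twice_differentiable_imp_isCont)

lemma eventually_in_open_isCont:
  "isCont f x \<Longrightarrow> open V \<Longrightarrow> f x \<in> V \<Longrightarrow> \<forall>\<^sub>F y in nhds x. f y \<in> V"
  by (rule eventually_nhds_compose) (simp_all add: eventually_nhds_in_open)

lemma twice_differentiable_into_Pair:
  assumes "twice_differentiable_into A f x" "twice_differentiable_into B g x"
  shows "twice_differentiable_into (prod_atlas A B) (\<lambda>y. (f y, g y)) x"
  using assms
  by (auto simp: twice_differentiable_into_def prod_atlas_def intro!: twice_differentiable_Pair isCont_Pair)

text \<open>Charts of a product come in pairs, so a chart of the other factor at
  \<open>snd (f x)\<close> is needed as well; \<open>open_atlas B\<close> supplies one.\<close>

lemma twice_differentiable_into_fst: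
  assumes "open_atlas B" "twice_differentiable_into (prod_atlas A B) f x"
  shows "twice_differentiable_into A (\<lambda>y. fst (f y)) x"
  unfolding twice_differentiable_into_def
proof safe
  show "isCont (\<lambda>y. fst (f y)) x"
    using twice_differentiable_into_isCont[OF assms(2)] by (rule isCont_fst)
  fix V \<psi> assume V: "(V, \<psi>) \<in> A" "fst (f x) \<in> V"
  obtain W \<rho> where "(W, \<rho>) \<in> B" "snd (f x) \<in> W"
    using open_atlas_cover[OF assms(1)] .
  then have "twice_differentiable_at (\<lambda>y. map_prod \<psi> \<rho> (f y)) x"
    using twice_differentiable_into_chart[OF assms(2) prod_atlasI[OF V(1)]] V(2)
    by (simp add: mem_Times_iff)
  from twice_differentiable_fst[OF this] show "twice_differentiable_at (\<lambda>y. \<psi> (fst (f y))) x"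
    by simp
qed

lemma twice_differentiable_into_snd:
  assumes "open_atlas A" "twice_differentiable_into (prod_atlas A B) f x"
  shows "twice_differentiable_into B (\<lambda>y. snd (f y)) x"
  unfolding twice_differentiable_into_def
proof safe
  show "isCont (\<lambda>y. snd (f y)) x"
    using twice_differentiable_into_isCont[OF assms(2)] by (rule isCont_snd)
  fix V \<psi> assume V: "(V, \<psi>) \<in> B" "snd (f x) \<in> V"
  obtain W \<rho> where "(W, \<rho>) \<in> A" "fst (f x) \<in> W"
    using open_atlas_cover[OF assms(1)] .
  then have "twice_differentiable_at (\<lambda>y. map_prod \<rho> \<psi> (f y)) x"
    using twice_differentiable_into_chart[OF assms(2) prod_atlasI[OF _ V(1)]] V(2)
    by (simp add: mem_Times_iff)
  from twice_differentiable_snd[OF this] show "twice_differentiable_at (\<lambda>y. \<psi> (snd (f y))) x"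
    by simp
qed

text \<open>The chain rule is assumed in a chart, so that it can be supplied by either
  \<open>twice_differentiable_compose\<close> or \<open>twice_differentiable_compose_affine\<close>.\<close>

lemma twice_differentiable_into_manifold_map_chart:
  fixes A :: "('g::t2_space, 'e::real_normed_vector) chart set"
    and B :: "('k::topological_space, 'f::real_normed_vector) chart set"
  assumes k: "manifold_map smooth_on A B S k" and S: "open S" "f x \<in> S"
    and A: "open_atlas A" and B: "open_atlas B"
    and f: "isCont f x" and U: "(U, \<phi>) \<in> A" "f x \<in> U"
    and chain: "\<And>H :: 'e \<Rightarrow> 'f. twice_differentiable_at H (\<phi> (f x)) \<Longrightarrow>
      twice_differentiable_at (\<lambda>y. H (\<phi> (f y))) x"
  shows "twice_differentiable_into B (\<lambda>y. k (f y)) x"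
  unfolding twice_differentiable_into_def
proof safe
  have "isCont k (f x)"
    using k S by (auto simp: manifold_map_def continuous_on_eq_continuous_at)
  then show "isCont (\<lambda>y. k (f y)) x"
    by (rule isCont_o2[OF f])
  fix V \<psi> assume V: "(V, \<psi>) \<in> B" "k (f x) \<in> V"
  note U' = open_atlas_chart[OF A U(1)]
  have "twice_differentiable_at (\<lambda>y. \<psi> (k (inv_into U \<phi> (\<phi> (f y))))) x"
    by (rule chain, rule manifold_map_twice_differentiable[OF k S A B U V])
  moreover have "\<forall>\<^sub>F y in nhds x. \<psi> (k (inv_into U \<phi> (\<phi> (f y)))) = \<psi> (k (f y))"
    using eventually_in_open_isCont[OF f U'(1) U(2)] by eventually_elim (simp add: U'(2))
  ultimately show "twice_differentiable_at (\<lambda>y. \<psi> (k (f y))) x"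
    by (rule twice_differentiable_cong_nhds)
qed

lemma twice_differentiable_into_manifold_map:
  fixes A :: "('g::t2_space, 'e::euclidean_space) chart set"
  assumes k: "manifold_map smooth_on A B S k" and S: "open S" "f x \<in> S"
    and A: "open_atlas A" and B: "open_atlas B"
    and f: "twice_differentiable_into A f x"
  shows "twice_differentiable_into B (\<lambda>y. k (f y)) x"
proof -
  obtain U \<phi> where U: "(U, \<phi>) \<in> A" "f x \<in> U"
    using open_atlas_cover[OF A] .
  show ?thesis
    by (rule twice_differentiable_into_manifold_map_chart[where f = f, OF k S A B _ U])
      (auto intro: twice_differentiable_into_isCont[OF f]
        twice_differentiable_compose twice_differentiable_into_chart[OF f U])
qed

section \<open>Left trivialisation of a Lie group\<close>

locale lie_group_chart =
  fixes G :: "'g::{t2_space, second_countable_topology} monoid" (structure)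
    and A :: "('g, 'e::euclidean_space) chart set"
    and \<kappa> :: "('g, 'e) chart"
  assumes lie: "lie_group G A" and chart: "unit_chart G A \<kappa>"
begin

abbreviation "pt \<equiv> point G \<kappa>"
abbreviation "cd \<equiv> coord G \<kappa>"

sublocale group G
  using lie by (simp add: lie_group_def)

lemma carrier_UNIV [simp]: "carrier G = UNIV"
  using lie by (simp add: lie_group_def)

lemma open_atlas: "open_atlas A"
  using lie by (simp add: lie_group_def atlas_imp_open_atlas)

lemma kappa: "(fst \<kappa>, snd \<kappa>) \<in> A" "\<one> \<in> fst \<kappa>"
  using chart by (auto simp: unit_chart_def)

lemmas kappa_chart = open_atlas_chart[OF open_atlas kappa(1)]

text \<open>The chart image shifted so that the unit sits at 0. Outside it the value of
  \<open>pt\<close> is unspecified, hence the many neighbourhood conditions below.\<close>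

definition coord_dom :: "'e set" where
  "coord_dom = (\<lambda>\<eta>. snd \<kappa> \<one> + \<eta>) -` (snd \<kappa> ` fst \<kappa>)"

lemma open_coord_dom: "open coord_dom"
  unfolding coord_dom_def
  by (rule open_vimage) (auto intro!: kappa_chart continuous_intros)

lemma zero_in_coord_dom: "0 \<in> coord_dom"
  using kappa by (simp add: coord_dom_def)

lemma eventually_coord_dom: "\<forall>\<^sub>F \<eta> in nhds 0. \<eta> \<in> coord_dom"
  using open_coord_dom zero_in_coord_dom by (rule eventually_nhds_in_open)

lemma pt_in_chart: "\<eta> \<in> coord_dom \<Longrightarrow> pt \<eta> \<in> fst \<kappa>"
  by (auto simp: point_def coord_dom_def intro!: inv_into_into)

lemma cd_pt [simp]: "\<eta> \<in> coord_dom \<Longrightarrow> cd (pt \<eta>) = \<eta>"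
  by (simp add: point_def coord_def coord_dom_def f_inv_into_f)

lemma pt_cd [simp]: "g \<in> fst \<kappa> \<Longrightarrow> pt (cd g) = g"
  by (simp add: point_def coord_def kappa_chart)

lemma cd_in_coord_dom: "g \<in> fst \<kappa> \<Longrightarrow> cd g \<in> coord_dom"
  by (simp add: coord_def coord_dom_def)

lemma cd_one [simp]: "cd \<one> = 0"
  by (simp add: coord_def)

lemma pt_zero [simp]: "pt 0 = \<one>"
  using pt_cd[OF kappa(2)] by simp

lemma inv_mult_cancel [simp]: "inv x \<otimes> (x \<otimes> y) = y" "x \<otimes> (inv x \<otimes> y) = y"
  by (simp_all add: m_assoc[symmetric])

section \<open>Regularity of the group operations\<close>

lemma isCont_mult_left: "isCont (\<lambda>x. g \<otimes> x) y"
proof -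
  have "isCont (\<lambda>p. fst p \<otimes> snd p) (g, y)"
    using lie by (simp add: lie_group_def manifold_map_def continuous_on_eq_continuous_at case_prod_unfold)
  moreover have "isCont (\<lambda>x. (g, x)) y"
    by (intro continuous_intros)
  ultimately show ?thesis
    using isCont_o2[where f = "\<lambda>x. (g, x)"] by fastforce
qed

lemma twice_differentiable_mult:
  assumes "twice_differentiable_into A f x" "twice_differentiable_into A g x"
  shows "twice_differentiable_into A (\<lambda>y. f y \<otimes> g y) x"
proof -
  have "manifold_map smooth_on (prod_atlas A A) A UNIV (\<lambda>(x, y). x \<otimes> y)"
    using lie by (simp add: lie_group_def)
  from twice_differentiable_into_manifold_map[OF this open_UNIV UNIV_I open_atlas_prod[OF open_atlas open_atlas]
      open_atlas twice_differentiable_into_Pair[OF assms]]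
  show ?thesis by simp
qed

lemma twice_differentiable_inv:
  assumes "twice_differentiable_into A f x"
  shows "twice_differentiable_into A (\<lambda>y. inv (f y)) x"
proof -
  have "manifold_map smooth_on A A UNIV (\<lambda>x. inv x)"
    using lie by (simp add: lie_group_def)
  from twice_differentiable_into_manifold_map[OF this open_UNIV UNIV_I open_atlas open_atlas assms]
  show ?thesis .
qed

lemma isCont_pt:
  assumes "\<eta> \<in> coord_dom"
  shows "isCont pt \<eta>"
proof -
  have "homeomorphism (fst \<kappa>) (snd \<kappa> ` fst \<kappa>) (snd \<kappa>) (inv_into (fst \<kappa>) (snd \<kappa>))"
    using lie kappa(1) by (auto simp: lie_group_def atlas_def)
  then have "isCont (inv_into (fst \<kappa>) (snd \<kappa>)) (snd \<kappa> \<one> + \<eta>)"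
    using assms kappa_chart(3)[OF subset_refl kappa_chart(1)]
    by (auto simp: homeomorphism_def continuous_on_eq_continuous_at coord_dom_def)
  moreover have "isCont (\<lambda>\<eta>. snd \<kappa> \<one> + \<eta>) \<eta>"
    by (intro continuous_intros)
  ultimately have "isCont (\<lambda>\<eta>. inv_into (fst \<kappa>) (snd \<kappa>) (snd \<kappa> \<one> + \<eta>)) \<eta>"
    by (rule isCont_o2[rotated])
  then show ?thesis
    by (simp add: point_def[abs_def])
qed

lemma twice_differentiable_pt:
  fixes u :: "'a::real_normed_vector \<Rightarrow> 'e"
  assumes u: "twice_differentiable_at u x" "u x \<in> coord_dom"
  shows "twice_differentiable_into A (\<lambda>y. pt (u y)) x"
  unfolding twice_differentiable_into_def
proof safe
  show "isCont (\<lambda>y. pt (u y)) x"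
    using twice_differentiable_imp_isCont[OF u(1)] isCont_pt[OF u(2)] by (rule isCont_o2)
  fix V \<psi> assume V: "(V, \<psi>) \<in> A" "pt (u x) \<in> V"
  have id: "manifold_map smooth_on A A UNIV (\<lambda>x. x)"
    using lie by (simp add: lie_group_def)
  have "snd \<kappa> (pt (u x)) = snd \<kappa> \<one> + u x"
    using cd_pt[OF u(2)] by (simp add: coord_def algebra_simps)
  then have "twice_differentiable_at (\<lambda>y. \<psi> (inv_into (fst \<kappa>) (snd \<kappa>) y)) (snd \<kappa> \<one> + u x)"
    using manifold_map_twice_differentiable[OF id open_UNIV UNIV_I open_atlas open_atlas
        kappa(1) pt_in_chart[OF u(2)] V] by simp
  from twice_differentiable_compose[OF this twice_differentiable_add[OF twice_differentiable_const u(1)]]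
  show "twice_differentiable_at (\<lambda>y. \<psi> (pt (u y))) x"
    by (simp add: point_def)
qed

lemma twice_differentiable_cd:
  assumes "twice_differentiable_into A f x" "f x \<in> fst \<kappa>"
  shows "twice_differentiable_at (\<lambda>y. cd (f y)) x"
  using twice_differentiable_add[OF twice_differentiable_into_chart[OF assms(1) kappa(1) assms(2)]
      twice_differentiable_const, of "- snd \<kappa> \<one>"]
  by (simp add: coord_def)

section \<open>The group law in coordinates at the unit\<close>

definition cmult :: "'e \<times> 'e \<Rightarrow> 'e" where
  "cmult p = cd (pt (fst p) \<otimes> pt (snd p))"

definition cinv :: "'e \<Rightarrow> 'e" where
  "cinv x = cd (inv (pt x))"

text \<open>The left Maurer--Cartan form in the chart: it turns a coordinate velocity at x into the
  left-trivialised velocity at \<open>pt x\<close>.\<close>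

definition maurer_cartan :: "'e \<Rightarrow> 'e \<Rightarrow> 'e" where
  "maurer_cartan x = frechet_derivative (\<lambda>y. cd (inv (pt x) \<otimes> pt y)) (at x)"

lemma twice_differentiable_cmult: "twice_differentiable_at cmult (0, 0)"
  unfolding cmult_def[abs_def]
  by (intro twice_differentiable_cd twice_differentiable_mult twice_differentiable_pt
      twice_differentiable_fst twice_differentiable_snd twice_differentiable_id)
     (simp_all add: zero_in_coord_dom kappa)

lemma twice_differentiable_cinv: "twice_differentiable_at cinv 0"
  unfolding cinv_def[abs_def]
  by (intro twice_differentiable_cd twice_differentiable_inv twice_differentiable_pt twice_differentiable_id)
     (simp_all add: zero_in_coord_dom kappa)

lemma cinv_zero [simp]: "cinv 0 = 0"
  by (simp add: cinv_def)

lemma cmult_unit [simp]: "x \<in> coord_dom \<Longrightarrow> cmult (x, 0) = x" "x \<in> coord_dom \<Longrightarrow> cmult (0, x) = x"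
  by (simp_all add: cmult_def)

lemma has_derivative_maurer_cartan:
  assumes "x \<in> coord_dom"
  shows "((\<lambda>y. cd (inv (pt x) \<otimes> pt y)) has_derivative maurer_cartan x) (at x)"
  unfolding maurer_cartan_def frechet_derivative_works[symmetric]
  by (intro twice_differentiable_imp_differentiable twice_differentiable_cd twice_differentiable_mult
      twice_differentiable_pt twice_differentiable_id twice_differentiable_into_const assms)
     (simp add: kappa)

lemma eventually_inv_pt: "\<forall>\<^sub>F x in nhds 0. inv (pt x) \<in> fst \<kappa>"
proof (rule eventually_in_open_isCont)
  have "twice_differentiable_into A (\<lambda>x. inv (pt x)) 0"
    by (intro twice_differentiable_inv twice_differentiable_pt twice_differentiable_id zero_in_coord_dom)
  then show "isCont (\<lambda>x. inv (pt x)) 0"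
    by (rule twice_differentiable_into_isCont)
qed (simp_all add: kappa kappa_chart)

text \<open>The unit laws fix both partial derivatives, and the derivative is their sum.\<close>

lemma has_derivative_cmult_zero: "(cmult has_derivative (\<lambda>p. fst p + snd p)) (at (0, 0))"
proof -
  obtain D where D: "(cmult has_derivative D) (at (0, 0))"
    using twice_differentiable_imp_differentiable[OF twice_differentiable_cmult]
    by (auto simp: differentiable_def)
  have "((\<lambda>y. (y, 0)) has_derivative (\<lambda>u. (u, 0))) (at (0 :: 'e))"
    "((\<lambda>y. (0, y)) has_derivative (\<lambda>u. (0, u))) (at (0 :: 'e))"
    by (auto intro!: derivative_eq_intros)
  from has_derivative_compose[OF this(1) D] has_derivative_compose[OF this(2) D]
  have "((\<lambda>y. cmult (y, 0)) has_derivative (\<lambda>u. D (u, 0))) (at 0)"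
    "((\<lambda>y. cmult (0, y)) has_derivative (\<lambda>u. D (0, u))) (at 0)" .
  moreover have "\<forall>\<^sub>F y in nhds 0. cmult (y, 0) = y" "\<forall>\<^sub>F y in nhds 0. cmult (0, y) = y"
    using eventually_coord_dom by (eventually_elim, simp)+
  ultimately have "(\<lambda>u. D (u, 0)) = (\<lambda>u. u)" "(\<lambda>u. D (0, u)) = (\<lambda>u. u)"
    by (auto intro: has_derivative_unique_nhds[OF _ has_derivative_ident])
  then have "D (u, 0) + D (0, v) = u + v" for u v
    by (simp add: fun_eq_iff)
  moreover have "D p = D (fst p, 0) + D (0, snd p)" for p
    using linear_add[OF has_derivative_linear[OF D], of "(fst p, 0)" "(0, snd p)"] by simp
  ultimately have "D = (\<lambda>p. fst p + snd p)"
    by presburger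
  with D show ?thesis by simp
qed

text \<open>Differentiate x^-1 x = e in coordinates at the unit.\<close>

lemma has_derivative_cinv_zero: "(cinv has_derivative uminus) (at 0)"
proof -
  obtain i' where i': "(cinv has_derivative i') (at 0)"
    using twice_differentiable_imp_differentiable[OF twice_differentiable_cinv]
    by (auto simp: differentiable_def)
  have "((\<lambda>x. (cinv x, x)) has_derivative (\<lambda>k. (i' k, k))) (at 0)"
    by (auto intro!: derivative_eq_intros i')
  from has_derivative_compose_eq[OF this _ has_derivative_cmult_zero]
  have "((\<lambda>x. cmult (cinv x, x)) has_derivative (\<lambda>k. i' k + k)) (at 0)"
    by simp
  moreover have "\<forall>\<^sub>F x in nhds 0. cmult (cinv x, x) = 0"
    using eventually_inv_pt by eventually_elim (simp add: cmult_def cinv_def)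
  ultimately have "(\<lambda>k. i' k + k) = (\<lambda>k. 0)"
    by (rule has_derivative_unique_nhds[OF _ has_derivative_const])
  then have "i' = uminus"
    by (simp add: fun_eq_iff eq_neg_iff_add_eq_0)
  with i' show ?thesis by simp
qed

text \<open>With \<open>B(u, v)\<close> the mixed second derivative of the multiplication at the unit, the derivative of
  the Maurer--Cartan form is \<open>- B(u, v)\<close> and the bracket is \<open>B(u, v) - B(v, u)\<close>.\<close>

lemma has_derivative_maurer_cartan_zero:
  obtains L where "\<And>v. ((\<lambda>x. maurer_cartan x v) has_derivative (\<lambda>k. L k v)) (at 0)"
    and "\<And>k v. L k v - L v k = - lie_bracket G \<kappa> k v"
proof -
  obtain m' m'' where m: "has_second_derivative cmult m' m'' (0, 0)"
    using twice_differentiable_cmult unfolding twice_differentiable_at_def by blast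
  have m': "\<forall>\<^sub>F z in nhds (0, 0). (cmult has_derivative m' z) (at z)"
    and m'': "\<And>v. ((\<lambda>z. m' z v) has_derivative (\<lambda>k. m'' k v)) (at (0, 0))"
    using m by (auto simp: has_second_derivative_def)
  note sym = second_derivative_symmetric[OF m]
  have lin'': "linear (\<lambda>k. m'' k v)" for v
    using has_derivative_linear[OF m''] .
  have ev: "\<forall>\<^sub>F x in nhds 0. (cmult has_derivative m' (p x)) (at (p x))"
    if "isCont p 0" "p 0 = (0, 0)" for p :: "'e \<Rightarrow> 'e \<times> 'e"
    using eventually_nhds_compose[OF that(1)] m' that(2) by simp
  have ev1: "\<forall>\<^sub>F x in nhds 0. (cmult has_derivative m' (x, 0)) (at (x, 0))"
    and ev2: "\<forall>\<^sub>F x in nhds 0. (cmult has_derivative m' (0, x)) (at (0, x))"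
    by (rule ev; simp)+
  \<comment> \<open>This and \<open>unit2\<close> hold on a whole neighbourhood of 0, so they can be
    differentiated once more; that kills the two pure second derivatives of \<open>cmult\<close> in
    \<open>m''1\<close> and \<open>m''2\<close>.\<close>
  have unit1: "\<forall>\<^sub>F x in nhds 0. \<forall>u. m' (x, 0) (u, 0) = u"
    using ev1 eventually_coord_dom
  proof eventually_elim
    case (elim x)
    have "((\<lambda>y. (y, 0)) has_derivative (\<lambda>u. (u, 0))) (at x)"
      by (auto intro!: derivative_eq_intros)
    from has_derivative_compose[OF this elim(1)]
    have "((\<lambda>y. cmult (y, 0)) has_derivative (\<lambda>u. m' (x, 0) (u, 0))) (at x)" .
    moreover have "\<forall>\<^sub>F y in nhds x. cmult (y, 0) = y"
      using eventually_nhds_in_open[OF open_coord_dom elim(2)] by eventually_elim simp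
    ultimately have "(\<lambda>u. m' (x, 0) (u, 0)) = (\<lambda>u. u)"
      by (rule has_derivative_unique_nhds[OF _ has_derivative_ident])
    then show ?case by (simp add: fun_eq_iff)
  qed
  have unit2: "\<forall>\<^sub>F x in nhds 0. \<forall>u. m' (0, x) (0, u) = u"
    using ev2 eventually_coord_dom
  proof eventually_elim
    case (elim x)
    have "((\<lambda>y. (0, y)) has_derivative (\<lambda>u. (0, u))) (at x)"
      by (auto intro!: derivative_eq_intros)
    from has_derivative_compose[OF this elim(1)]
    have "((\<lambda>y. cmult (0, y)) has_derivative (\<lambda>u. m' (0, x) (0, u))) (at x)" .
    moreover have "\<forall>\<^sub>F y in nhds x. cmult (0, y) = y"
      using eventually_nhds_in_open[OF open_coord_dom elim(2)] by eventually_elim simp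
    ultimately have "(\<lambda>u. m' (0, x) (0, u)) = (\<lambda>u. u)"
      by (rule has_derivative_unique_nhds[OF _ has_derivative_ident])
    then show ?case by (simp add: fun_eq_iff)
  qed
  have m''1: "m'' (k, 0) (u, 0) = 0" for k u
  proof -
    have "((\<lambda>y. (y, 0)) has_derivative (\<lambda>u. (u, 0))) (at (0 :: 'e))"
      by (auto intro!: derivative_eq_intros)
    from has_derivative_compose[OF this m'']
    have "((\<lambda>y. m' (y, 0) (u, 0)) has_derivative (\<lambda>k. m'' (k, 0) (u, 0))) (at 0)" .
    moreover have "\<forall>\<^sub>F y in nhds 0. m' (y, 0) (u, 0) = u"
      using unit1 by eventually_elim simp
    ultimately have "(\<lambda>k. m'' (k, 0) (u, 0)) = (\<lambda>k. 0)"
      by (rule has_derivative_unique_nhds[OF _ has_derivative_const])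
    then show ?thesis by (rule fun_cong)
  qed
  have m''2: "m'' (0, k) (0, u) = 0" for k u
  proof -
    have "((\<lambda>y. (0, y)) has_derivative (\<lambda>u. (0, u))) (at (0 :: 'e))"
      by (auto intro!: derivative_eq_intros)
    from has_derivative_compose[OF this m'']
    have "((\<lambda>y. m' (0, y) (0, u)) has_derivative (\<lambda>k. m'' (0, k) (0, u))) (at 0)" .
    moreover have "\<forall>\<^sub>F y in nhds 0. m' (0, y) (0, u) = u"
      using unit2 by eventually_elim simp
    ultimately have "(\<lambda>k. m'' (0, k) (0, u)) = (\<lambda>k. 0)"
      by (rule has_derivative_unique_nhds[OF _ has_derivative_const])
    then show ?thesis by (rule fun_cong)
  qed
  have m'00: "m' (0, 0) (u, v) = u + v" for u v
    using has_derivative_unique[OF eventually_nhds_x_imp_x[OF m'] has_derivative_cmult_zero] by simp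
  have cinv_pair: "((\<lambda>x. (cinv x, x)) has_derivative (\<lambda>k. (- k, k))) (at 0)"
    "((\<lambda>x. (x, cinv x)) has_derivative (\<lambda>k. (k, - k))) (at 0)"
    by (auto intro!: derivative_eq_intros has_derivative_cinv_zero)
  have ev3: "\<forall>\<^sub>F x in nhds 0. (cmult has_derivative m' (cinv x, x)) (at (cinv x, x))"
    and ev4: "\<forall>\<^sub>F x in nhds 0. (cmult has_derivative m' (x, cinv x)) (at (x, cinv x))"
    by (rule ev; use cinv_pair[THEN has_derivative_continuous] in simp)+
  \<comment> \<open>With \<open>cinv x\<close> frozen, y runs through the second slot of
    \<open>cmult\<close>, hence the direction \<open>(0, v)\<close> at
    \<open>(cinv x, x)\<close>.\<close>
  have mc_eq: "\<forall>\<^sub>F x in nhds 0. maurer_cartan x v = m' (cinv x, x) (0, v)" for v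
    using ev3 eventually_inv_pt
  proof eventually_elim
    case (elim x)
    have "((\<lambda>y. (cinv x, y)) has_derivative (\<lambda>u. (0, u))) (at x)"
      by (auto intro!: derivative_eq_intros)
    from has_derivative_compose[OF this elim(1)]
    have "((\<lambda>y. cmult (cinv x, y)) has_derivative (\<lambda>u. m' (cinv x, x) (0, u))) (at x)" .
    also have "(\<lambda>y. cmult (cinv x, y)) = (\<lambda>y. cd (inv (pt x) \<otimes> pt y))"
      using elim(2) by (simp add: cmult_def cinv_def)
    finally show ?case
      by (simp add: maurer_cartan_def frechet_derivative_at[symmetric])
  qed
  \<comment> \<open>The base point \<open>(cinv x, x)\<close> has velocity \<open>(- k, k)\<close>
    at 0.\<close>
  define L where "L k v = m'' (- k, k) (0, v)" for k v
  show thesis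
  proof
    show "((\<lambda>x. maurer_cartan x v) has_derivative (\<lambda>k. L k v)) (at 0)" for v
      unfolding has_derivative_cong_nhds[OF mc_eq] L_def
      by (rule has_derivative_compose_eq[OF cinv_pair(1) _ m'']) simp
    have L_eq: "L k v = - m'' (k, 0) (0, v)" for k v
      using linear_add[OF lin'', of "(- k, 0)" "(0, k)"] linear_neg[OF lin'', of "(k, 0)"]
      by (simp add: L_def m''2)
    have bracket: "lie_bracket G \<kappa> k v = m'' (k, 0) (0, v) - m'' (v, 0) (0, k)" for k v
    proof -
      have Ad_eq: "\<forall>\<^sub>F x in nhds 0. Ad G \<kappa> (pt x) v = m' (x, cinv x) (m' (x, 0) (0, v), 0)"
        using ev4 ev1 eventually_inv_pt eventually_coord_dom
      proof eventually_elim
        case (elim x)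
        have "((\<lambda>y. (x, y)) has_derivative (\<lambda>u. (0, u))) (at 0)"
          by (auto intro!: derivative_eq_intros)
        from has_derivative_compose[OF this elim(2)]
        have "((\<lambda>y. (cmult (x, y), cinv x)) has_derivative (\<lambda>u. (m' (x, 0) (0, u), 0))) (at 0)"
          by (auto intro!: derivative_eq_intros)
        from has_derivative_compose_eq[OF this _ elim(1)] elim(4)
        have "((\<lambda>y. cmult (cmult (x, y), cinv x)) has_derivative
            (\<lambda>u. m' (x, cinv x) (m' (x, 0) (0, u), 0))) (at 0)"
          by simp
        moreover have "\<forall>\<^sub>F y in nhds 0. pt x \<otimes> pt y \<in> fst \<kappa>"
        proof (rule eventually_in_open_isCont)
          have "twice_differentiable_into A (\<lambda>y. pt x \<otimes> pt y) 0"
            by (intro twice_differentiable_mult twice_differentiable_pt twice_differentiable_id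
                twice_differentiable_into_const zero_in_coord_dom)
          then show "isCont (\<lambda>y. pt x \<otimes> pt y) 0"
            by (rule twice_differentiable_into_isCont)
        qed (use elim(4) pt_in_chart in \<open>simp_all add: kappa_chart\<close>)
        then have "\<forall>\<^sub>F y in nhds 0. cmult (cmult (x, y), cinv x) = cd (pt x \<otimes> pt y \<otimes> inv (pt x))"
          by eventually_elim (use elim(3) in \<open>simp add: cmult_def cinv_def\<close>)
        ultimately have "((\<lambda>y. cd (pt x \<otimes> pt y \<otimes> inv (pt x))) has_derivative
            (\<lambda>u. m' (x, cinv x) (m' (x, 0) (0, u), 0))) (at 0)"
          by (simp add: has_derivative_cong_nhds)
        then show ?case
          by (simp add: Ad_def frechet_derivative_at[symmetric])
      qed
      have K: "((\<lambda>x. m' (x, cinv x) (w, 0)) has_derivative (\<lambda>k. m'' (k, - k) (w, 0))) (at 0)" for w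
        by (rule has_derivative_compose_eq[OF cinv_pair(2) _ m'']) simp
      have lin: "\<forall>\<^sub>F x in nhds 0. linear (\<lambda>w. m' (x, cinv x) (w, 0))"
        using ev4
      proof eventually_elim
        case (elim x)
        show ?case
          using linear_compose[of "\<lambda>w. (w, 0)" "m' (x, cinv x)"] has_derivative_linear[OF elim]
          by (simp add: o_def linear_iff)
      qed
      have "((\<lambda>y. (y, 0)) has_derivative (\<lambda>u. (u, 0))) (at (0 :: 'e))"
        by (auto intro!: derivative_eq_intros)
      from has_derivative_compose[OF this m'']
      have u: "((\<lambda>x. m' (x, 0) (0, v)) has_derivative (\<lambda>k. m'' (k, 0) (0, v))) (at 0)" .
      have "((\<lambda>x. Ad G \<kappa> (pt x) v) has_derivative
          (\<lambda>k. m'' (k, - k) (v, 0) + m'' (k, 0) (0, v))) (at 0)"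
        unfolding has_derivative_cong_nhds[OF Ad_eq]
        using has_derivative_family_apply[OF K lin u] by (simp add: m'00)
      then have "lie_bracket G \<kappa> k v = m'' (k, - k) (v, 0) + m'' (k, 0) (0, v)"
        by (simp add: lie_bracket_def frechet_derivative_at[symmetric])
      also have "m'' (k, - k) (v, 0) = - m'' (0, k) (v, 0)"
        using linear_diff[OF lin'', of "(k, 0)" "(0, k)" "(v, 0)"] by (simp add: m''1)
      \<comment> \<open>Symmetry of the second derivative identifies the two orders of mixed
        differentiation.\<close>
      finally show ?thesis
        using sym[of "(0, k)" "(v, 0)"] by simp
    qed
    show "L k v - L v k = - lie_bracket G \<kappa> k v" for k v
      by (simp add: L_eq bracket)
  qed
qed

end

section \<open>The map \<tau>, its local inverse and their derivatives\<close>

lemma real_analytic_imp_smooth: "manifold_map real_analytic_on A B S f \<Longrightarrow> manifold_map smooth_on A B S f"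
  by (erule manifold_map_mono) (simp add: real_analytic_on_def)

locale lie_group_retraction = lie_group_chart G A \<kappa>
  for G :: "'g::{t2_space, second_countable_topology} monoid" (structure)
    and A :: "('g, 'e::euclidean_space) chart set" and \<kappa> +
  fixes U :: "'e set" and \<tau> :: "'e \<Rightarrow> 'g"
  assumes tau: "local_diffeo_at_unit G A U \<tau>"
begin

abbreviation "\<tau>inv \<equiv> inv_into U \<tau>"

text \<open>\<tau> is analytic for an analytic structure B compatible with A. Passing to smooth maps
  and composing with the identity between A and B brings its regularity to the given atlas.\<close>

lemma analytic_atlas:
  obtains B :: "('g, 'e) chart set" where "open_atlas B"
    and "manifold_map smooth_on B A UNIV (\<lambda>x. x)" and "manifold_map smooth_on A B UNIV (\<lambda>x. x)"
    and "manifold_map smooth_on vec_atlas B U \<tau>" and "manifold_map smooth_on B vec_atlas (\<tau> ` U) \<tau>inv"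
proof -
  obtain B :: "('g, 'e) chart set" where "analytic_lie_group G B" "compatible A B"
    "manifold_map real_analytic_on vec_atlas B U \<tau>" "manifold_map real_analytic_on B vec_atlas (\<tau> ` U) \<tau>inv"
    using tau unfolding local_diffeo_at_unit_def by blast
  then show thesis
    by (intro that[of B])
      (simp_all add: analytic_lie_group_def compatible_def atlas_imp_open_atlas real_analytic_imp_smooth)
qed

lemma tau_simps:
  shows "open U" "open (\<tau> ` U)" "inj_on \<tau> U" "x \<in> U \<Longrightarrow> - x \<in> U"
  using tau by (simp_all add: local_diffeo_at_unit_def)

lemma tau_uminus: "x \<in> U \<Longrightarrow> \<tau> (- x) = inv (\<tau> x)"
  using tau inv_equality[of "\<tau> (- x)" "\<tau> x"] by (simp add: local_diffeo_at_unit_def)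

lemma tau_tauinv [simp]: "g \<in> \<tau> ` U \<Longrightarrow> \<tau> (\<tau>inv g) = g"
  by (rule f_inv_into_f)

lemma tauinv_tau [simp]: "x \<in> U \<Longrightarrow> \<tau>inv (\<tau> x) = x"
  using tau_simps by simp

lemma tauinv_in: "g \<in> \<tau> ` U \<Longrightarrow> \<tau>inv g \<in> U"
  by (rule inv_into_into)

lemma twice_differentiable_tau:
  assumes "twice_differentiable_at u x" "u x \<in> U"
  shows "twice_differentiable_into A (\<lambda>y. \<tau> (u y)) x"
proof -
  obtain B :: "('g, 'e) chart set" where B: "open_atlas B" "manifold_map smooth_on B A UNIV (\<lambda>x. x)"
    "manifold_map smooth_on A B UNIV (\<lambda>x. x)" "manifold_map smooth_on vec_atlas B U \<tau>"
    "manifold_map smooth_on B vec_atlas (\<tau> ` U) \<tau>inv"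
    using analytic_atlas .
  have "twice_differentiable_into B (\<lambda>y. \<tau> (u y)) x"
    by (rule twice_differentiable_into_manifold_map[where f = u, OF B(4) tau_simps(1) assms(2) open_atlas_vec B(1)])
      (simp add: twice_differentiable_into_vec assms)
  from twice_differentiable_into_manifold_map[OF B(2) open_UNIV UNIV_I B(1) open_atlas this]
  show ?thesis .
qed

lemma twice_differentiable_tauinv:
  assumes "twice_differentiable_into A f x" "f x \<in> \<tau> ` U"
  shows "twice_differentiable_at (\<lambda>y. \<tau>inv (f y)) x"
proof -
  obtain B :: "('g, 'e) chart set" where B: "open_atlas B" "manifold_map smooth_on B A UNIV (\<lambda>x. x)"
    "manifold_map smooth_on A B UNIV (\<lambda>x. x)" "manifold_map smooth_on vec_atlas B U \<tau>"
    "manifold_map smooth_on B vec_atlas (\<tau> ` U) \<tau>inv"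
    using analytic_atlas .
  have "twice_differentiable_into B f x"
    using twice_differentiable_into_manifold_map[OF B(3) open_UNIV UNIV_I open_atlas B(1) assms(1)] .
  from twice_differentiable_into_manifold_map[where f = f, OF B(5) tau_simps(2) assms(2) B(1) open_atlas_vec this]
  show ?thesis by (simp add: twice_differentiable_into_vec)
qed

lemma has_derivative_dtau:
  assumes "x \<in> U"
  shows "((\<lambda>y. cd (\<tau> y \<otimes> inv (\<tau> x))) has_derivative dtau G \<kappa> \<tau> x) (at x)"
proof -
  have "(\<lambda>y. cd (\<tau> y \<otimes> inv (\<tau> x))) differentiable at x"
    by (intro twice_differentiable_imp_differentiable twice_differentiable_cd twice_differentiable_mult
        twice_differentiable_tau twice_differentiable_id twice_differentiable_into_const assms)
      (simp add: kappa)
  then show ?thesis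
    unfolding frechet_derivative_works dtau_def[abs_def] .
qed

text \<open>A curve whose right-trivialised velocity is that of \<open>\<eta> \<mapsto> point(\<eta>)\<^sup>-\<^sup>1\<close> inverts \<open>d\<tau>\<close>.\<close>

lemma dtau_inv_unique:
  assumes x: "x \<in> U" and R: "(R has_derivative R') (at 0)" "R 0 = x"
    and eq: "\<forall>\<^sub>F \<eta> in nhds 0. \<tau> (R \<eta>) \<otimes> inv (\<tau> x) = inv (pt \<eta>)"
  shows "dtau_inv G \<kappa> \<tau> x = (\<lambda>v. - R' v)" and "bij (dtau G \<kappa> \<tau> x)"
proof -
  have lin: "linear (dtau G \<kappa> \<tau> x)" "linear R'"
    using has_derivative_dtau[OF x] R by (auto intro: has_derivative_linear)
  \<comment> \<open>Differentiating \<open>eq\<close> shows that d\<tau> after R' is minus the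
    identity; so d\<tau> is onto and, in finite dimension, bijective.\<close>
  have "((\<lambda>\<eta>. cd (\<tau> (R \<eta>) \<otimes> inv (\<tau> x))) has_derivative (\<lambda>v. dtau G \<kappa> \<tau> x (R' v))) (at 0)"
    by (rule has_derivative_compose_eq[OF R has_derivative_dtau[OF x]])
  moreover have "\<forall>\<^sub>F \<eta> in nhds 0. cd (\<tau> (R \<eta>) \<otimes> inv (\<tau> x)) = cinv \<eta>"
    using eq by eventually_elim (simp add: cinv_def)
  ultimately have "(\<lambda>v. dtau G \<kappa> \<tau> x (R' v)) = uminus"
    by (rule has_derivative_unique_nhds[OF _ has_derivative_cinv_zero])
  then have "dtau G \<kappa> \<tau> x (R' v) = - v" for v
    by (rule fun_cong)
  then have right_inv: "dtau G \<kappa> \<tau> x (- R' v) = v" for v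
    by (simp add: linear_neg[OF lin(1)])
  then have "surj (dtau G \<kappa> \<tau> x)"
    unfolding surj_def by (intro allI exI) (rule sym)
  with lin(1) show bij: "bij (dtau G \<kappa> \<tau> x)"
    by (simp add: bij_def linear_surjective_imp_injective)
  show "dtau_inv G \<kappa> \<tau> x = (\<lambda>v. - R' v)"
    unfolding dtau_inv_def
    by (rule inv_unique_comp) (use right_inv bij in \<open>auto simp: fun_eq_iff bij_def inj_eq dest: injD\<close>)
qed

text \<open>Because \<tau>(-x) is the inverse of \<tau>(x), the negative of this map satisfies the
  hypothesis of \<open>dtau_inv_unique\<close> at -x. This is how the base point acquires its
  sign.\<close>

lemma has_derivative_tauinv_right:
  assumes x: "x \<in> U"
  shows "((\<lambda>\<eta>. \<tau>inv (\<tau> x \<otimes> pt \<eta>)) has_derivative dtau_inv G \<kappa> \<tau> (- x)) (at 0)"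
    and "bij (dtau G \<kappa> \<tau> (- x))"
proof -
  let ?Q = "\<lambda>\<eta>. \<tau>inv (\<tau> x \<otimes> pt \<eta>)"
  have tdi: "twice_differentiable_into A (\<lambda>\<eta>. \<tau> x \<otimes> pt \<eta>) 0"
    by (intro twice_differentiable_mult twice_differentiable_into_const twice_differentiable_pt
        twice_differentiable_id zero_in_coord_dom)
  have ev: "\<forall>\<^sub>F \<eta> in nhds 0. \<tau> x \<otimes> pt \<eta> \<in> \<tau> ` U"
    by (rule eventually_in_open_isCont[OF twice_differentiable_into_isCont[OF tdi] tau_simps(2)])
      (simp add: x)
  have "?Q differentiable at 0"
    by (rule twice_differentiable_imp_differentiable[OF twice_differentiable_tauinv[OF tdi]]) (simp add: x)
  then obtain Q' where Q': "(?Q has_derivative Q') (at 0)"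
    by (auto simp: differentiable_def)
  then have "((\<lambda>\<eta>. - ?Q \<eta>) has_derivative (\<lambda>v. - Q' v)) (at 0)"
    by (rule has_derivative_minus)
  moreover have "- ?Q 0 = - x"
    by (simp add: x)
  moreover have "\<forall>\<^sub>F \<eta> in nhds 0. \<tau> (- ?Q \<eta>) \<otimes> inv (\<tau> (- x)) = inv (pt \<eta>)"
    using ev by eventually_elim (simp add: tau_uminus x tauinv_in inv_mult_group m_assoc)
  ultimately have "dtau_inv G \<kappa> \<tau> (- x) = (\<lambda>v. - (- Q' v))" "bij (dtau G \<kappa> \<tau> (- x))"
    using tau_simps(4)[OF x] by (blast dest: dtau_inv_unique)+
  with Q' show "(?Q has_derivative dtau_inv G \<kappa> \<tau> (- x)) (at 0)" "bij (dtau G \<kappa> \<tau> (- x))"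
    by simp_all
qed

lemma surj_dtau_inv: "x \<in> U \<Longrightarrow> surj (dtau_inv G \<kappa> \<tau> (- x))"
  unfolding dtau_inv_def
  by (intro bij_is_surj bij_imp_bij_inv has_derivative_tauinv_right)

lemma linear_dtau_inv:
  assumes "x \<in> U"
  shows "linear (dtau_inv G \<kappa> \<tau> x)"
  using has_derivative_linear[OF has_derivative_tauinv_right(1)[OF tau_simps(4)[OF assms]]] by simp

text \<open>This map satisfies the hypothesis of \<open>dtau_inv_unique\<close> at x as it stands,
  hence the base point x and the minus sign in the derivative.\<close>

lemma has_derivative_tauinv_left:
  assumes x: "x \<in> U"
  shows "((\<lambda>\<eta>. \<tau>inv (inv (pt \<eta>) \<otimes> \<tau> x)) has_derivative (\<lambda>v. - dtau_inv G \<kappa> \<tau> x v)) (at 0)"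
proof -
  let ?R = "\<lambda>\<eta>. \<tau>inv (inv (pt \<eta>) \<otimes> \<tau> x)"
  have tdi: "twice_differentiable_into A (\<lambda>\<eta>. inv (pt \<eta>) \<otimes> \<tau> x) 0"
    by (intro twice_differentiable_mult twice_differentiable_inv twice_differentiable_into_const
        twice_differentiable_pt twice_differentiable_id zero_in_coord_dom)
  have ev: "\<forall>\<^sub>F \<eta> in nhds 0. inv (pt \<eta>) \<otimes> \<tau> x \<in> \<tau> ` U"
    by (rule eventually_in_open_isCont[OF twice_differentiable_into_isCont[OF tdi] tau_simps(2)])
      (simp add: x)
  have "?R differentiable at 0"
    by (rule twice_differentiable_imp_differentiable[OF twice_differentiable_tauinv[OF tdi]]) (simp add: x)
  then obtain R' where R': "(?R has_derivative R') (at 0)"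
    by (auto simp: differentiable_def)
  moreover have "?R 0 = x"
    by (simp add: x)
  moreover have "\<forall>\<^sub>F \<eta> in nhds 0. \<tau> (?R \<eta>) \<otimes> inv (\<tau> x) = inv (pt \<eta>)"
    using ev by eventually_elim (simp add: m_assoc)
  ultimately have "dtau_inv G \<kappa> \<tau> x = (\<lambda>v. - R' v)"
    using x by (blast dest: dtau_inv_unique)
  with R' show ?thesis by simp
qed

text \<open>The linearisation of \<tau>^-1(g_0^-1 g_1) in both end points. Its two terms produce the
  momenta of \<open>node\<close> and \<open>initial_cond\<close>; differentiability reduces it to
  the one-sided cases.\<close>

lemma has_derivative_tauinv_both:
  assumes x: "x \<in> U"
  shows "((\<lambda>p. \<tau>inv (inv (pt (fst p)) \<otimes> \<tau> x \<otimes> pt (snd p))) has_derivative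
    (\<lambda>p. dtau_inv G \<kappa> \<tau> (- x) (snd p) - dtau_inv G \<kappa> \<tau> x (fst p))) (at (0, 0))"
proof -
  let ?T = "\<lambda>p. \<tau>inv (inv (pt (fst p)) \<otimes> \<tau> x \<otimes> pt (snd p))"
  have "?T differentiable at (0, 0)"
    by (intro twice_differentiable_imp_differentiable twice_differentiable_tauinv
        twice_differentiable_mult twice_differentiable_inv twice_differentiable_into_const
        twice_differentiable_pt twice_differentiable_id twice_differentiable_fst twice_differentiable_snd)
      (simp_all add: zero_in_coord_dom x)
  then obtain T' where T': "(?T has_derivative T') (at (0, 0))"
    by (auto simp: differentiable_def)
  have "((\<lambda>y. (y, 0)) has_derivative (\<lambda>u. (u, 0))) (at (0 :: 'e))"
    "((\<lambda>y. (0, y)) has_derivative (\<lambda>u. (0, u))) (at (0 :: 'e))"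
    by (auto intro!: derivative_eq_intros)
  from has_derivative_compose[OF this(1) T'] has_derivative_compose[OF this(2) T']
  have "(\<lambda>u. T' (u, 0)) = (\<lambda>v. - dtau_inv G \<kappa> \<tau> x v)" "(\<lambda>u. T' (0, u)) = dtau_inv G \<kappa> \<tau> (- x)"
    using has_derivative_tauinv_left[OF x] has_derivative_tauinv_right(1)[OF x]
    by (auto dest: has_derivative_unique)
  then have "T' (u, 0) = - dtau_inv G \<kappa> \<tau> x u" "T' (0, u) = dtau_inv G \<kappa> \<tau> (- x) u" for u
    by (simp_all add: fun_eq_iff)
  then have "T' p = dtau_inv G \<kappa> \<tau> (- x) (snd p) - dtau_inv G \<kappa> \<tau> x (fst p)" for p
    using linear_add[OF has_derivative_linear[OF T'], of "(fst p, 0)" "(0, snd p)"] by simp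
  then have "T' = (\<lambda>p. dtau_inv G \<kappa> \<tau> (- x) (snd p) - dtau_inv G \<kappa> \<tau> x (fst p))"
    by (rule ext)
  with T' show ?thesis by simp
qed

end

section \<open>The first step of a discrete path\<close>

lemma dual_separates: "(\<And>f :: 'e::euclidean_space dual. blinfun_apply f x = 0) \<Longrightarrow> x = 0"
  by (metis blinfun_inner_right.rep_eq inner_eq_zero_iff)

text \<open>\<open>Blinfun\<close> is meaningful only for bounded linear arguments, and in finite
  dimension linearity of L gives boundedness.\<close>

lemma dual_map_apply:
  fixes L :: "'e::euclidean_space \<Rightarrow> 'e"
  assumes "linear L"
  shows "blinfun_apply (dual_map L \<mu>) v = blinfun_apply \<mu> (L v)"
  unfolding dual_map_def
  using bounded_linear_compose[OF blinfun.bounded_linear_right linear_conv_bounded_linear[THEN iffD1, OF assms], of \<mu>]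
  by (simp add: bounded_linear_Blinfun_apply)

lemma dual_map_zero [simp]: "dual_map L 0 = 0"
  by (simp add: dual_map_def) (simp add: zero_blinfun_def)

locale discrete_hohp = lie_group_retraction G A \<kappa> U \<tau>
  for G :: "'g::{t2_space, second_countable_topology} monoid" (structure)
    and A :: "('g, 'e::euclidean_space) chart set" and \<kappa> and U and \<tau> +
  fixes l :: "'e \<times> 'e \<Rightarrow> real"
    and h :: real and a :: "'s::finite \<Rightarrow> 's \<Rightarrow> real" and b :: "'s \<Rightarrow> real"
    and N :: nat
  assumes smooth_l: "smooth_on UNIV l" and h_pos: "h > 0" and N_pos: "N \<ge> 1"
begin

abbreviation "path_action \<equiv> action G U \<tau> l h a b N"
abbreviation "path_solution \<equiv> solution G \<kappa> U \<tau> l h a b N"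
abbreviation "l' \<equiv> \<lambda>p. frechet_derivative l (at p)"

lemma has_derivative_l: "(l has_derivative l' p) (at p)"
  using twice_differentiable_imp_differentiable[OF smooth_on_imp_twice_differentiable[OF smooth_l]]
  by (simp add: frechet_derivative_works)

section \<open>Stationarity in the first step\<close>

definition step_action :: "nat \<Rightarrow> ('g, 'e, 's) dpath \<Rightarrow> real" where
  "step_action k \<gamma> =
     (\<Sum>i\<in>UNIV.
        b i * l (st_xi \<gamma> k i, st_v \<gamma> k i)
        + blinfun_apply (st_mu \<gamma> k i)
            ((1 / h) *\<^sub>R \<tau>inv (inv (node_g \<gamma> k) \<otimes> st_g \<gamma> k i)
             - (\<Sum>j\<in>UNIV. a i j *\<^sub>R st_xi \<gamma> k j))
        + blinfun_apply (st_nu \<gamma> k i)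
            ((1 / h) *\<^sub>R (st_xi \<gamma> k i - node_xi \<gamma> k)
             - (\<Sum>j\<in>UNIV. a i j *\<^sub>R st_v \<gamma> k j)))
     + blinfun_apply (node_cmu \<gamma> (k + 1))
         ((1 / h) *\<^sub>R \<tau>inv (inv (node_g \<gamma> k) \<otimes> node_g \<gamma> (k + 1))
          - (\<Sum>i\<in>UNIV. b i *\<^sub>R st_xi \<gamma> k i))
     + blinfun_apply (node_nu \<gamma> (k + 1))
         ((1 / h) *\<^sub>R (node_xi \<gamma> (k + 1) - node_xi \<gamma> k)
          - (\<Sum>i\<in>UNIV. b i *\<^sub>R st_v \<gamma> k i))"

lemma action_eq_step_action: "path_action \<gamma> = h * (\<Sum>k<N. step_action k \<gamma>)"
  by (simp only: action_def step_action_def)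

text \<open>The multipliers \<open>node_cmu\<close> and \<open>node_nu\<close> of step 0 carry index
  1, its stage variables index 0. The nodes g and \<xi> stay fixed, so the endpoint conditions of
  \<open>solution\<close> hold for every N, including N = 1, where node 1 is the end point.\<close>

definition first_step_variation ::
  "'e dual \<Rightarrow> 'e dual \<Rightarrow> ('s \<Rightarrow> 'e) \<Rightarrow> ('s \<Rightarrow> 'e) \<Rightarrow> ('s \<Rightarrow> 'e) \<Rightarrow> ('s \<Rightarrow> 'e dual) \<Rightarrow> ('e, 'e, 's) dpath"
  where "first_step_variation cm n sg sx sv sn = \<lparr>
     node_g = (\<lambda>k. 0), node_xi = (\<lambda>k. 0),
     node_cmu = (\<lambda>k. if k = 1 then cm else 0), node_nu = (\<lambda>k. if k = 1 then n else 0),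
     st_g = (\<lambda>k. if k = 0 then sg else (\<lambda>i. 0)), st_xi = (\<lambda>k. if k = 0 then sx else (\<lambda>i. 0)),
     st_v = (\<lambda>k. if k = 0 then sv else (\<lambda>i. 0)), st_mu = (\<lambda>k i. 0),
     st_nu = (\<lambda>k. if k = 0 then sn else (\<lambda>i. 0))\<rparr>"

text \<open>The varied components occur in summand 0 only, so the other summands are constant in
  \<epsilon>; then h is divided out.\<close>

lemma step_action_stationary:
  assumes "path_solution \<gamma>"
  shows "((\<lambda>\<epsilon>. step_action 0 (vary G \<kappa> \<gamma> (first_step_variation cm n sg sx sv sn) \<epsilon>))
    has_real_derivative 0) (at 0)"
proof -
  let ?\<delta> = "first_step_variation cm n sg sx sv sn"
  have later: "step_action k (vary G \<kappa> \<gamma> ?\<delta> \<epsilon>) = step_action k \<gamma>" if "k \<in> {1..<N}" for k \<epsilon>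
    using that by (simp add: step_action_def vary_def first_step_variation_def)
  have "{..<N} = insert 0 {1..<N}"
    using N_pos by auto
  then have "path_action (vary G \<kappa> \<gamma> ?\<delta> \<epsilon>) =
      h * (step_action 0 (vary G \<kappa> \<gamma> ?\<delta> \<epsilon>) + (\<Sum>k\<in>{1..<N}. step_action k \<gamma>))" for \<epsilon>
    unfolding action_eq_step_action by (simp add: later)
  moreover have "((\<lambda>\<epsilon>. path_action (vary G \<kappa> \<gamma> ?\<delta> \<epsilon>)) has_real_derivative 0) (at 0)"
    using assms by (simp add: solution_def first_step_variation_def)
  ultimately have "((\<lambda>\<epsilon>. h * (step_action 0 (vary G \<kappa> \<gamma> ?\<delta> \<epsilon>) + (\<Sum>k\<in>{1..<N}. step_action k \<gamma>)))
      has_real_derivative 0) (at 0)"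
    by simp
  from DERIV_cmult[OF this, of "1 / h"]
  have "((\<lambda>\<epsilon>. step_action 0 (vary G \<kappa> \<gamma> ?\<delta> \<epsilon>) + (\<Sum>k\<in>{1..<N}. step_action k \<gamma>))
      has_real_derivative 0) (at 0)"
    using h_pos by simp
  from DERIV_diff[OF this DERIV_const[of "\<Sum>k\<in>{1..<N}. step_action k \<gamma>"]] show ?thesis
    by simp
qed

text \<open>One linearisation for all directions at once. The individual equations follow by setting
  most directions to 0.\<close>

lemma first_step_variational_equation:
  assumes sol: "path_solution \<gamma>"
  defines "\<Xi> \<equiv> st_xi \<gamma> 0" and "V \<equiv> st_v \<gamma> 0"
  shows "(\<Sum>i\<in>UNIV. b i * l' (\<Xi> i, V i) (sx i, sv i)
      + blinfun_apply (st_mu \<gamma> 0 i)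
          ((1 / h) *\<^sub>R dtau_inv G \<kappa> \<tau> (- \<tau>inv (inv (node_g \<gamma> 0) \<otimes> st_g \<gamma> 0 i)) (sg i)
            - (\<Sum>j\<in>UNIV. a i j *\<^sub>R sx j))
      + (blinfun_apply (st_nu \<gamma> 0 i) ((1 / h) *\<^sub>R sx i - (\<Sum>j\<in>UNIV. a i j *\<^sub>R sv j))
        + blinfun_apply (sn i) ((1 / h) *\<^sub>R (\<Xi> i - node_xi \<gamma> 0) - (\<Sum>j\<in>UNIV. a i j *\<^sub>R V j))))
      + (blinfun_apply (node_cmu \<gamma> 1) (- (\<Sum>i\<in>UNIV. b i *\<^sub>R sx i))
        + blinfun_apply cm ((1 / h) *\<^sub>R \<tau>inv (inv (node_g \<gamma> 0) \<otimes> node_g \<gamma> 1) - (\<Sum>i\<in>UNIV. b i *\<^sub>R \<Xi> i)))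
      + (blinfun_apply (node_nu \<gamma> 1) (- (\<Sum>i\<in>UNIV. b i *\<^sub>R sv i))
        + blinfun_apply n ((1 / h) *\<^sub>R (node_xi \<gamma> 1 - node_xi \<gamma> 0) - (\<Sum>i\<in>UNIV. b i *\<^sub>R V i))) = 0"
    (is "?D = 0")
proof -
  let ?x = "\<lambda>i. \<tau>inv (inv (node_g \<gamma> 0) \<otimes> st_g \<gamma> 0 i)"
  have adm: "inv (node_g \<gamma> 0) \<otimes> st_g \<gamma> 0 i \<in> \<tau> ` U" for i
    using sol N_pos by (auto simp: solution_def admissible_def)
  note bilinear = bounded_bilinear.has_vector_derivative[OF bounded_bilinear_blinfun_apply]
  have scaled: "((\<lambda>\<epsilon>. c *\<^sub>R f \<epsilon>) has_vector_derivative c *\<^sub>R d) (at 0)"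
    if "(f has_vector_derivative d) (at 0)" for f :: "real \<Rightarrow> 'e" and c d
    using that by (rule bounded_linear.has_vector_derivative[OF bounded_linear_scaleR_right])
  have line: "((\<lambda>\<epsilon>. x + \<epsilon> *\<^sub>R y) has_vector_derivative y) (at 0)"
    for x y :: "'c::real_normed_vector"
    by (auto intro!: derivative_eq_intros)
  have shifted: "((\<lambda>\<epsilon>. x + \<epsilon> *\<^sub>R y - z) has_vector_derivative y) (at 0)" for x y z :: 'e
    by (auto intro!: derivative_eq_intros)
  have sums: "((\<lambda>\<epsilon>. \<Sum>j\<in>UNIV. c j *\<^sub>R (f j + \<epsilon> *\<^sub>R d j)) has_vector_derivative (\<Sum>j\<in>UNIV. c j *\<^sub>R d j)) (at 0)"
    for c and f d :: "'s \<Rightarrow> 'e"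
    by (intro has_vector_derivative_sum scaled line)
  have Q: "((\<lambda>\<epsilon>. \<tau>inv (inv (node_g \<gamma> 0) \<otimes> (st_g \<gamma> 0 i \<otimes> pt (\<epsilon> *\<^sub>R sg i)))) has_vector_derivative
      dtau_inv G \<kappa> \<tau> (- ?x i) (sg i)) (at 0)" for i
  proof -
    \<comment> \<open>The base point is written as \<tau> of a point of U to fit
      \<open>has_derivative_tauinv_right\<close>.\<close>
    have "((\<lambda>\<epsilon>. \<tau>inv (\<tau> (?x i) \<otimes> pt (\<epsilon> *\<^sub>R sg i))) has_derivative
        (\<lambda>\<epsilon>. dtau_inv G \<kappa> \<tau> (- ?x i) (\<epsilon> *\<^sub>R sg i))) (at 0)"
      by (rule has_derivative_compose_eq[OF _ _ has_derivative_tauinv_right(1)[OF tauinv_in[OF adm]]])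
        (auto intro!: derivative_eq_intros)
    then show ?thesis
      by (simp add: adm m_assoc has_vector_derivative_def
          linear_cmul[OF linear_dtau_inv[OF tau_simps(4)[OF tauinv_in[OF adm[of i]]]]])
  qed
  have L: "((\<lambda>\<epsilon>. l (\<Xi> i + \<epsilon> *\<^sub>R sx i, V i + \<epsilon> *\<^sub>R sv i)) has_vector_derivative
      l' (\<Xi> i, V i) (sx i, sv i)) (at 0)" for i
  proof -
    have "((\<lambda>\<epsilon>. l (\<Xi> i + \<epsilon> *\<^sub>R sx i, V i + \<epsilon> *\<^sub>R sv i)) has_derivative
      (\<lambda>\<epsilon>. l' (\<Xi> i, V i) (\<epsilon> *\<^sub>R sx i, \<epsilon> *\<^sub>R sv i))) (at 0)"
      by (rule has_derivative_compose_eq[OF _ _ has_derivative_l]) (auto intro!: derivative_eq_intros)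
    then show ?thesis
      using linear_cmul[OF has_derivative_linear[OF has_derivative_l], of _ _ "(sx i, sv i)"]
      by (simp add: has_vector_derivative_def)
  qed
  have stage: "((\<lambda>\<epsilon>. b i * l (\<Xi> i + \<epsilon> *\<^sub>R sx i, V i + \<epsilon> *\<^sub>R sv i)
      + blinfun_apply (st_mu \<gamma> 0 i)
          ((1 / h) *\<^sub>R \<tau>inv (inv (node_g \<gamma> 0) \<otimes> (st_g \<gamma> 0 i \<otimes> pt (\<epsilon> *\<^sub>R sg i)))
            - (\<Sum>j\<in>UNIV. a i j *\<^sub>R (\<Xi> j + \<epsilon> *\<^sub>R sx j)))
      + blinfun_apply (st_nu \<gamma> 0 i + \<epsilon> *\<^sub>R sn i)
          ((1 / h) *\<^sub>R (\<Xi> i + \<epsilon> *\<^sub>R sx i - node_xi \<gamma> 0)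
            - (\<Sum>j\<in>UNIV. a i j *\<^sub>R (V j + \<epsilon> *\<^sub>R sv j)))) has_vector_derivative
      b i * l' (\<Xi> i, V i) (sx i, sv i)
      + blinfun_apply (st_mu \<gamma> 0 i)
          ((1 / h) *\<^sub>R dtau_inv G \<kappa> \<tau> (- ?x i) (sg i) - (\<Sum>j\<in>UNIV. a i j *\<^sub>R sx j))
      + (blinfun_apply (st_nu \<gamma> 0 i) ((1 / h) *\<^sub>R sx i - (\<Sum>j\<in>UNIV. a i j *\<^sub>R sv j))
        + blinfun_apply (sn i) ((1 / h) *\<^sub>R (\<Xi> i - node_xi \<gamma> 0) - (\<Sum>j\<in>UNIV. a i j *\<^sub>R V j)))) (at 0)" for i
    using has_vector_derivative_add[OF has_vector_derivative_add[OF
        bounded_linear.has_vector_derivative[OF bounded_linear_mult_right[of "b i"] L[of i]]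
        bounded_linear.has_vector_derivative[OF blinfun.bounded_linear_right
          has_vector_derivative_diff[OF scaled[OF Q[of i]] sums]]]
        bilinear[OF line has_vector_derivative_diff[OF scaled[OF shifted] sums]],
        of "st_mu \<gamma> 0 i" "1 / h" "a i" \<Xi> sx "st_nu \<gamma> 0 i" "sn i" "1 / h" "\<Xi> i" "sx i" "node_xi \<gamma> 0" "a i" V sv]
    by simp
  have cmu: "((\<lambda>\<epsilon>. blinfun_apply (node_cmu \<gamma> 1 + \<epsilon> *\<^sub>R cm)
        ((1 / h) *\<^sub>R \<tau>inv (inv (node_g \<gamma> 0) \<otimes> node_g \<gamma> 1) - (\<Sum>i\<in>UNIV. b i *\<^sub>R (\<Xi> i + \<epsilon> *\<^sub>R sx i))))
      has_vector_derivative
      blinfun_apply (node_cmu \<gamma> 1) (- (\<Sum>i\<in>UNIV. b i *\<^sub>R sx i))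
        + blinfun_apply cm ((1 / h) *\<^sub>R \<tau>inv (inv (node_g \<gamma> 0) \<otimes> node_g \<gamma> 1) - (\<Sum>i\<in>UNIV. b i *\<^sub>R \<Xi> i))) (at 0)"
    using bilinear[OF line has_vector_derivative_diff[OF has_vector_derivative_const sums],
        of "node_cmu \<gamma> 1" cm "(1 / h) *\<^sub>R \<tau>inv (inv (node_g \<gamma> 0) \<otimes> node_g \<gamma> 1)" b \<Xi> sx] by simp
  have nu: "((\<lambda>\<epsilon>. blinfun_apply (node_nu \<gamma> 1 + \<epsilon> *\<^sub>R n)
        ((1 / h) *\<^sub>R (node_xi \<gamma> 1 - node_xi \<gamma> 0) - (\<Sum>i\<in>UNIV. b i *\<^sub>R (V i + \<epsilon> *\<^sub>R sv i))))
      has_vector_derivative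
      blinfun_apply (node_nu \<gamma> 1) (- (\<Sum>i\<in>UNIV. b i *\<^sub>R sv i))
        + blinfun_apply n ((1 / h) *\<^sub>R (node_xi \<gamma> 1 - node_xi \<gamma> 0) - (\<Sum>i\<in>UNIV. b i *\<^sub>R V i))) (at 0)"
    using bilinear[OF line has_vector_derivative_diff[OF has_vector_derivative_const sums],
        of "node_nu \<gamma> 1" n "(1 / h) *\<^sub>R (node_xi \<gamma> 1 - node_xi \<gamma> 0)" b V sv] by simp
  have "((\<lambda>\<epsilon>. step_action 0 (vary G \<kappa> \<gamma> (first_step_variation cm n sg sx sv sn) \<epsilon>))
      has_vector_derivative ?D) (at 0)"
    using has_vector_derivative_add[OF has_vector_derivative_add[OF has_vector_derivative_sum[OF stage] cmu] nu]
    by (simp add: step_action_def vary_def first_step_variation_def \<Xi>_def V_def)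
  then have "((\<lambda>\<epsilon>. step_action 0 (vary G \<kappa> \<gamma> (first_step_variation cm n sg sx sv sn) \<epsilon>))
      has_real_derivative ?D) (at 0)"
    by (simp add: has_real_derivative_iff_has_vector_derivative)
  then show ?thesis
    using step_action_stationary[OF sol] DERIV_unique by blast
qed

section \<open>Equations satisfied by a solution in its first step\<close>

lemma solution_arguments:
  assumes "path_solution \<gamma>"
  shows "inv (node_g \<gamma> 0) \<otimes> node_g \<gamma> 1 \<in> \<tau> ` U" "inv (node_g \<gamma> 0) \<otimes> st_g \<gamma> 0 i \<in> \<tau> ` U"
  using assms N_pos by (auto simp: solution_def admissible_def)

text \<open>Varying a single multiplier leaves its constraint paired with an arbitrary functional,
  and functionals separate points.\<close>

lemma solution_constraints:
  assumes sol: "path_solution \<gamma>"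
  shows "\<tau>inv (inv (node_g \<gamma> 0) \<otimes> node_g \<gamma> 1) = h *\<^sub>R Xi_node b \<gamma> 1"
    and "node_xi \<gamma> 1 - node_xi \<gamma> 0 = h *\<^sub>R (\<Sum>i\<in>UNIV. b i *\<^sub>R st_v \<gamma> 0 i)"
    and "st_xi \<gamma> 0 i - node_xi \<gamma> 0 = h *\<^sub>R (\<Sum>j\<in>UNIV. a i j *\<^sub>R st_v \<gamma> 0 j)"
proof -
  have l0: "l' p (0, 0) = 0" for p
    using linear_0[OF has_derivative_linear[OF has_derivative_l]] by (simp add: zero_prod_def)
  have d0: "dtau_inv G \<kappa> \<tau> (- \<tau>inv (inv (node_g \<gamma> 0) \<otimes> st_g \<gamma> 0 i)) 0 = 0" for i
    by (intro linear_0 linear_dtau_inv tau_simps(4) tauinv_in solution_arguments[OF sol])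
  have rescale: "x = h *\<^sub>R y" if "(1 / h) *\<^sub>R x - y = 0" for x y :: 'e
    using that h_pos by (auto simp: field_simps)
  note eq = first_step_variational_equation[OF sol]
  have "blinfun_apply cm ((1 / h) *\<^sub>R \<tau>inv (inv (node_g \<gamma> 0) \<otimes> node_g \<gamma> 1) - (\<Sum>i\<in>UNIV. b i *\<^sub>R st_xi \<gamma> 0 i)) = 0"
    for cm :: "'e dual"
    using eq[of "\<lambda>_. 0" "\<lambda>_. 0" "\<lambda>_. 0" "\<lambda>_. 0" cm 0] by (simp add: l0 d0)
  from rescale[OF dual_separates[OF this]]
  show "\<tau>inv (inv (node_g \<gamma> 0) \<otimes> node_g \<gamma> 1) = h *\<^sub>R Xi_node b \<gamma> 1"
    by (simp add: Xi_node_def)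
  have "blinfun_apply n ((1 / h) *\<^sub>R (node_xi \<gamma> 1 - node_xi \<gamma> 0) - (\<Sum>i\<in>UNIV. b i *\<^sub>R st_v \<gamma> 0 i)) = 0" for n :: "'e dual"
    using eq[of "\<lambda>_. 0" "\<lambda>_. 0" "\<lambda>_. 0" "\<lambda>_. 0" 0 n] by (simp add: l0 d0)
  from rescale[OF dual_separates[OF this]]
  show "node_xi \<gamma> 1 - node_xi \<gamma> 0 = h *\<^sub>R (\<Sum>i\<in>UNIV. b i *\<^sub>R st_v \<gamma> 0 i)" .
  have "blinfun_apply n ((1 / h) *\<^sub>R (st_xi \<gamma> 0 i - node_xi \<gamma> 0) - (\<Sum>j\<in>UNIV. a i j *\<^sub>R st_v \<gamma> 0 j)) = 0" for n :: "'e dual"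
  proof -
    have *: "blinfun_apply (if k = i then n else 0) x = (if k = i then blinfun_apply n x else 0)"
      for k and x :: 'e
      by simp
    show ?thesis
      using eq[of "\<lambda>_. 0" "\<lambda>_. 0" "\<lambda>_. 0" "\<lambda>k. if k = i then n else 0" 0 0]
      by (simp add: l0 d0 *)
  qed
  from rescale[OF dual_separates[OF this]]
  show "st_xi \<gamma> 0 i - node_xi \<gamma> 0 = h *\<^sub>R (\<Sum>j\<in>UNIV. a i j *\<^sub>R st_v \<gamma> 0 j)" .
qed

text \<open>The stage point \<open>G\<^sub>0\<^sup>i\<close> enters the functional only through its own constraint.\<close>

lemma solution_stage_momentum:
  assumes sol: "path_solution \<gamma>"
  shows "st_mu \<gamma> 0 i = 0"
proof (rule blinfun_eqI)
  fix w
  let ?d = "\<lambda>i. dtau_inv G \<kappa> \<tau> (- \<tau>inv (inv (node_g \<gamma> 0) \<otimes> st_g \<gamma> 0 i))"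
  \<comment> \<open>The stage point is moved so that \<tau>^-1(g_0^-1 G_0^i) has velocity w, which
    is possible because d\<tau>^-1 is onto.\<close>
  obtain v where v: "?d i v = w"
    using surj_dtau_inv[OF tauinv_in[OF solution_arguments(2)[OF sol]]] by (metis surjD)
  have l0: "l' p (0, 0) = 0" for p
    using linear_0[OF has_derivative_linear[OF has_derivative_l]] by (simp add: zero_prod_def)
  have d0: "?d k 0 = 0" for k
    by (intro linear_0 linear_dtau_inv tau_simps(4) tauinv_in solution_arguments[OF sol])
  have *: "blinfun_apply (st_mu \<gamma> 0 k) ((1 / h) *\<^sub>R ?d k (if k = i then v else 0)) =
      (if k = i then blinfun_apply (st_mu \<gamma> 0 i) w / h else 0)" for k
    by (simp add: v d0 blinfun.scaleR_right)
  show "blinfun_apply (st_mu \<gamma> 0 i) w = blinfun_apply 0 w"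
    using first_step_variational_equation[OF sol, of "\<lambda>_. 0" "\<lambda>_. 0" "\<lambda>k. if k = i then v else 0" "\<lambda>_. 0" 0 0] h_pos
    by (simp add: l0 *)
qed

text \<open>Stationarity in \<Xi> and V, grouped by constraint: when u and v are the velocities of a
  family of solutions, the three arguments on the right are the variations of h \<Xi>_1, of \<xi>_1
  - \<xi>_0 and of \<xi>_0.\<close>

lemma solution_stage_equation:
  assumes sol: "path_solution \<gamma>"
  shows "h * (\<Sum>i\<in>UNIV. b i * l' (st_xi \<gamma> 0 i, st_v \<gamma> 0 i) (u i, v i)) =
    blinfun_apply (node_cmu \<gamma> 1) (h *\<^sub>R (\<Sum>i\<in>UNIV. b i *\<^sub>R u i))
    + blinfun_apply (node_nu \<gamma> 1) (h *\<^sub>R (\<Sum>i\<in>UNIV. b i *\<^sub>R v i))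
    - (\<Sum>i\<in>UNIV. blinfun_apply (st_nu \<gamma> 0 i) (u i - h *\<^sub>R (\<Sum>j\<in>UNIV. a i j *\<^sub>R v j)))"
proof -
  have "(\<Sum>i\<in>UNIV. b i * l' (st_xi \<gamma> 0 i, st_v \<gamma> 0 i) (u i, v i))
      + (\<Sum>i\<in>UNIV. blinfun_apply (st_nu \<gamma> 0 i) ((1 / h) *\<^sub>R u i - (\<Sum>j\<in>UNIV. a i j *\<^sub>R v j)))
      = blinfun_apply (node_cmu \<gamma> 1) (\<Sum>i\<in>UNIV. b i *\<^sub>R u i)
        + blinfun_apply (node_nu \<gamma> 1) (\<Sum>i\<in>UNIV. b i *\<^sub>R v i)"
    using first_step_variational_equation[OF sol, of u v "\<lambda>_. 0" "\<lambda>_. 0" 0 0]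
    by (simp add: solution_stage_momentum[OF sol] sum.distrib blinfun.minus_right)
  from arg_cong[OF this, of "\<lambda>x. h * x"]
  have "h * (\<Sum>i\<in>UNIV. b i * l' (st_xi \<gamma> 0 i, st_v \<gamma> 0 i) (u i, v i))
      + h * (\<Sum>i\<in>UNIV. blinfun_apply (st_nu \<gamma> 0 i) ((1 / h) *\<^sub>R u i - (\<Sum>j\<in>UNIV. a i j *\<^sub>R v j)))
      = h * blinfun_apply (node_cmu \<gamma> 1) (\<Sum>i\<in>UNIV. b i *\<^sub>R u i)
        + h * blinfun_apply (node_nu \<gamma> 1) (\<Sum>i\<in>UNIV. b i *\<^sub>R v i)"
    by (simp only: distrib_left)
  moreover have "h * (\<Sum>i\<in>UNIV. blinfun_apply (st_nu \<gamma> 0 i) ((1 / h) *\<^sub>R u i - (\<Sum>j\<in>UNIV. a i j *\<^sub>R v j)))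
      = (\<Sum>i\<in>UNIV. blinfun_apply (st_nu \<gamma> 0 i) (u i - h *\<^sub>R (\<Sum>j\<in>UNIV. a i j *\<^sub>R v j)))"
    unfolding sum_distrib_left
  proof (rule sum.cong[OF refl])
    fix i
    have "u i - h *\<^sub>R (\<Sum>j\<in>UNIV. a i j *\<^sub>R v j) = h *\<^sub>R ((1 / h) *\<^sub>R u i - (\<Sum>j\<in>UNIV. a i j *\<^sub>R v j))"
      using h_pos by (simp add: scaleR_diff_right)
    then show "h * blinfun_apply (st_nu \<gamma> 0 i) ((1 / h) *\<^sub>R u i - (\<Sum>j\<in>UNIV. a i j *\<^sub>R v j))
      = blinfun_apply (st_nu \<gamma> 0 i) (u i - h *\<^sub>R (\<Sum>j\<in>UNIV. a i j *\<^sub>R v j))"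
      by (simp only: blinfun.scaleR_right real_scaleR_def)
  qed
  ultimately show ?thesis
    by (simp add: blinfun.scaleR_right)
qed

text \<open>The stage momenta are 0 and \<open>dual_map\<close> sends 0 to 0, so the sum over the
  stages drops out of the initial momentum.\<close>

lemma solution_initial_cond:
  assumes "path_solution \<gamma>"
  shows "initial_cond G \<kappa> \<tau> h a b \<gamma> =
    (node_g \<gamma> 0, node_xi \<gamma> 0, dual_map (dtau_inv G \<kappa> \<tau> (h *\<^sub>R Xi_node b \<gamma> 1)) (node_cmu \<gamma> 1),
      node_nu \<gamma> 1 + (\<Sum>i\<in>UNIV. st_nu \<gamma> 0 i))"
  by (simp add: initial_cond_def solution_stage_momentum[OF assms])

text \<open>Differentiating the constraints along the family expresses the stage velocities
  occurring in \<open>solution_stage_equation\<close> by the velocities of the end nodes. The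
  parameter \<open>w0\<close> is arbitrary because the formula is used on a neighbourhood and then
  differentiated again.\<close>

lemma has_derivative_first_step:
  fixes \<gamma> :: "'w::real_normed_vector \<Rightarrow> ('g, 'e, 's) dpath"
  assumes sol: "\<And>w. path_solution (\<gamma> w)"
    and init: "initial_cond G \<kappa> \<tau> h a b (\<gamma> w0) = (g0, \<xi>0, \<mu>0, \<nu>0)"
    and final: "node G \<kappa> \<tau> h b (\<gamma> w0) 1 = (g1, \<xi>1, \<mu>1, \<nu>1)"
    and cont: "isCont (\<lambda>w. node_g (\<gamma> w) 0) w0" "isCont (\<lambda>w. node_g (\<gamma> w) 1) w0"
    and \<eta>0: "((\<lambda>w. cd (inv g0 \<otimes> node_g (\<gamma> w) 0)) has_derivative \<eta>0) (at w0)"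
    and \<eta>1: "((\<lambda>w. cd (inv g1 \<otimes> node_g (\<gamma> w) 1)) has_derivative \<eta>1) (at w0)"
    and x0: "((\<lambda>w. node_xi (\<gamma> w) 0) has_derivative x0) (at w0)"
    and x1: "((\<lambda>w. node_xi (\<gamma> w) 1) has_derivative x1) (at w0)"
    and stage: "\<And>i. (\<lambda>w. st_xi (\<gamma> w) 0 i) differentiable at w0" "\<And>i. (\<lambda>w. st_v (\<gamma> w) 0 i) differentiable at w0"
  shows "((\<lambda>w. h * (\<Sum>i\<in>UNIV. b i * l (st_xi (\<gamma> w) 0 i, st_v (\<gamma> w) 0 i))) has_derivative
    (\<lambda>v. blinfun_apply \<mu>1 (\<eta>1 v) + blinfun_apply \<nu>1 (x1 v) - blinfun_apply \<mu>0 (\<eta>0 v) - blinfun_apply \<nu>0 (x0 v)))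
    (at w0)"
proof -
  define X where "X w = h *\<^sub>R Xi_node b (\<gamma> w) 1" for w
  let ?y = "inv g0 \<otimes> g1"
  have X_eq: "X w = \<tau>inv (inv (node_g (\<gamma> w) 0) \<otimes> node_g (\<gamma> w) 1)" for w
    using solution_constraints(1)[OF sol] by (simp add: X_def)
  have node0: "g0 = node_g (\<gamma> w0) 0" "\<mu>0 = dual_map (dtau_inv G \<kappa> \<tau> (X w0)) (node_cmu (\<gamma> w0) 1)"
    "\<nu>0 = node_nu (\<gamma> w0) 1 + (\<Sum>i\<in>UNIV. st_nu (\<gamma> w0) 0 i)"
    using init unfolding solution_initial_cond[OF sol] X_def by simp_all
  have node1: "g1 = node_g (\<gamma> w0) 1" "\<mu>1 = dual_map (dtau_inv G \<kappa> \<tau> (- X w0)) (node_cmu (\<gamma> w0) 1)"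
    "\<nu>1 = node_nu (\<gamma> w0) 1"
    using final unfolding node_def X_def by simp_all
  have y: "?y \<in> \<tau> ` U"
    using solution_arguments(1)[OF sol] by (simp add: node0 node1)
  have X0: "X w0 \<in> U" "\<tau> (X w0) = ?y"
    using y X_eq[of w0] by (simp_all add: node0 node1 tauinv_in)
  \<comment> \<open>Near \<open>w0\<close> the translated nodes stay in the chart domain, so
    \<open>pt (cd ...)\<close> gives them back.\<close>
  have near: "\<forall>\<^sub>F w in nhds w0. inv (f w0) \<otimes> f w \<in> fst \<kappa>" if f: "isCont f w0" for f :: "'w \<Rightarrow> 'g"
  proof (rule eventually_nhds_compose[OF f])
    have "isCont (\<lambda>x. inv (f w0) \<otimes> x) (f w0)"
      by (rule isCont_mult_left)
    then have "\<forall>\<^sub>F x in at (f w0). inv (f w0) \<otimes> x \<in> fst \<kappa>"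
      unfolding isCont_def by (rule topological_tendstoD) (simp_all add: kappa kappa_chart)
    then show "\<forall>\<^sub>F x in nhds (f w0). inv (f w0) \<otimes> x \<in> fst \<kappa>"
      by (simp add: eventually_nhds_conv_at kappa)
  qed
  \<comment> \<open>Coordinates of both end nodes around their values at \<open>w0\<close>. With
    components e_0 and e_1, g_0^-1 g_1 becomes the product of the inverse of pt(e_0), \<tau>(X w0)
    and pt(e_1).\<close>
  let ?e = "\<lambda>w. (cd (inv g0 \<otimes> node_g (\<gamma> w) 0), cd (inv g1 \<otimes> node_g (\<gamma> w) 1))"
  have "(?e has_derivative (\<lambda>v. (\<eta>0 v, \<eta>1 v))) (at w0)"
    by (rule has_derivative_Pair[OF \<eta>0 \<eta>1])
  moreover have "?e w0 = (0, 0)"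
    by (simp add: node0 node1)
  ultimately have "((\<lambda>w. \<tau>inv (inv (pt (fst (?e w))) \<otimes> \<tau> (X w0) \<otimes> pt (snd (?e w)))) has_derivative
      (\<lambda>v. dtau_inv G \<kappa> \<tau> (- X w0) (snd (\<eta>0 v, \<eta>1 v)) - dtau_inv G \<kappa> \<tau> (X w0) (fst (\<eta>0 v, \<eta>1 v)))) (at w0)"
    by (rule has_derivative_compose_eq[OF _ _ has_derivative_tauinv_both[OF X0(1)]])
  moreover have "\<forall>\<^sub>F w in nhds w0. \<tau>inv (inv (pt (fst (?e w))) \<otimes> \<tau> (X w0) \<otimes> pt (snd (?e w))) = X w"
    using near[OF cont(1)] near[OF cont(2)]
  proof eventually_elim
    case (elim w)
    then show ?case
      by (simp add: X0 X_eq[of w] node0 node1 inv_mult_group m_assoc)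
  qed
  ultimately have X': "(X has_derivative
      (\<lambda>v. dtau_inv G \<kappa> \<tau> (- X w0) (\<eta>1 v) - dtau_inv G \<kappa> \<tau> (X w0) (\<eta>0 v))) (at w0)"
    by (simp add: has_derivative_cong_nhds)
  obtain \<Xi>' V' where \<Xi>': "\<And>i. ((\<lambda>w. st_xi (\<gamma> w) 0 i) has_derivative \<Xi>' i) (at w0)"
    and V': "\<And>i. ((\<lambda>w. st_v (\<gamma> w) 0 i) has_derivative V' i) (at w0)"
    using stage unfolding differentiable_def by metis
  \<comment> \<open>The derivative of X through the stages must agree with the one through the end
    nodes.\<close>
  have "(X has_derivative (\<lambda>v. h *\<^sub>R (\<Sum>i\<in>UNIV. b i *\<^sub>R \<Xi>' i v))) (at w0)"
    unfolding X_def Xi_node_def by (auto intro!: derivative_eq_intros \<Xi>')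
  from has_derivative_unique[OF this X']
  have X_deriv: "h *\<^sub>R (\<Sum>i\<in>UNIV. b i *\<^sub>R \<Xi>' i v) =
      dtau_inv G \<kappa> \<tau> (- X w0) (\<eta>1 v) - dtau_inv G \<kappa> \<tau> (X w0) (\<eta>0 v)" for v
    by (rule fun_cong)
  have "((\<lambda>w. node_xi (\<gamma> w) 1 - node_xi (\<gamma> w) 0) has_derivative (\<lambda>v. h *\<^sub>R (\<Sum>i\<in>UNIV. b i *\<^sub>R V' i v))) (at w0)"
    unfolding solution_constraints(2)[OF sol] by (auto intro!: derivative_eq_intros V')
  from has_derivative_unique[OF this has_derivative_diff[OF x1 x0]]
  have V_deriv: "h *\<^sub>R (\<Sum>i\<in>UNIV. b i *\<^sub>R V' i v) = x1 v - x0 v" for v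
    by (rule fun_cong)
  have "((\<lambda>w. st_xi (\<gamma> w) 0 i - node_xi (\<gamma> w) 0) has_derivative
      (\<lambda>v. h *\<^sub>R (\<Sum>j\<in>UNIV. a i j *\<^sub>R V' j v))) (at w0)" for i
    unfolding solution_constraints(3)[OF sol] by (auto intro!: derivative_eq_intros V')
  from has_derivative_unique[OF this has_derivative_diff[OF \<Xi>' x0]]
  have \<Xi>_deriv: "h *\<^sub>R (\<Sum>j\<in>UNIV. a i j *\<^sub>R V' j v) = \<Xi>' i v - x0 v" for i v
    by (rule fun_cong)
  have "((\<lambda>w. l (st_xi (\<gamma> w) 0 i, st_v (\<gamma> w) 0 i)) has_derivative
      (\<lambda>v. l' (st_xi (\<gamma> w0) 0 i, st_v (\<gamma> w0) 0 i) (\<Xi>' i v, V' i v))) (at w0)" for i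
    by (rule has_derivative_compose[OF has_derivative_Pair[OF \<Xi>' V'] has_derivative_l])
  then have "((\<lambda>w. h * (\<Sum>i\<in>UNIV. b i * l (st_xi (\<gamma> w) 0 i, st_v (\<gamma> w) 0 i))) has_derivative
      (\<lambda>v. h * (\<Sum>i\<in>UNIV. b i * l' (st_xi (\<gamma> w0) 0 i, st_v (\<gamma> w0) 0 i) (\<Xi>' i v, V' i v)))) (at w0)"
    by (auto intro!: derivative_eq_intros)
  \<comment> \<open>The maps d\<tau>^-1 at -X and at X are absorbed into \<open>\<mu>1\<close> and
    \<open>\<mu>0\<close>; the multiplier \<open>\<nu>1\<close> and the stage \<nu>'s, all paired
    with the variation of \<xi>_0, add up to \<open>\<nu>0\<close>.\<close>
  also have "(\<lambda>v. h * (\<Sum>i\<in>UNIV. b i * l' (st_xi (\<gamma> w0) 0 i, st_v (\<gamma> w0) 0 i) (\<Xi>' i v, V' i v))) =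
      (\<lambda>v. blinfun_apply \<mu>1 (\<eta>1 v) + blinfun_apply \<nu>1 (x1 v) - blinfun_apply \<mu>0 (\<eta>0 v) - blinfun_apply \<nu>0 (x0 v))"
    unfolding solution_stage_equation[OF sol] X_deriv V_deriv \<Xi>_deriv node0(2,3) node1(2,3)
    using X0(1) tau_simps(4)[OF X0(1)]
    by (simp add: dual_map_apply linear_dtau_inv blinfun.add_left blinfun.sum_left blinfun.diff_right algebra_simps)
  finally show ?thesis .
qed

end

section \<open>Left trivialisation of the cotangent bundle\<close>

context lie_group_chart
begin

lemma open_atlas_TTG: "open_atlas (TTG_atlas A)"
  by (simp add: TTG_atlas_def open_atlas_prod open_atlas_vec open_atlas)

text \<open>The summand \<open>snd w + snd z\<close> exhibits the vector part as affine in w, as the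
  composition rule for the dual factors requires.\<close>

lemma TTG_point_eq: "TTG_point G \<kappa> z w = (fst z \<otimes> pt (fst w), snd w + snd z)"
  by (cases z, cases w) (simp add: TTG_point_def add.commute)

lemma isCont_TTG_point:
  assumes "fst w \<in> coord_dom"
  shows "isCont (TTG_point G \<kappa> z) w"
proof -
  have "isCont (\<lambda>w. pt (fst w)) w"
    by (rule isCont_o2[where f = fst, OF _ isCont_pt[OF assms]]) (intro continuous_intros)
  then have "isCont (\<lambda>w. fst z \<otimes> pt (fst w)) w"
    by (rule isCont_o2[OF _ isCont_mult_left])
  moreover have "isCont (\<lambda>w. snd w + snd z) w"
    by (intro continuous_intros)
  ultimately have "isCont (\<lambda>w. (fst z \<otimes> pt (fst w), snd w + snd z)) w"
    by (rule isCont_Pair)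
  then show ?thesis
    unfolding TTG_point_eq[abs_def] .
qed

text \<open>In a chart \<open>map_prod \<phi> id\<close> the group component has Euclidean values
  and the rest is affine, so \<open>twice_differentiable_compose_affine\<close> supplies the chain
  rule.\<close>

lemma twice_differentiable_TTG_point:
  fixes B :: "('k::topological_space, 'f::real_normed_vector) chart set"
  assumes f: "manifold_map smooth_on (TTG_atlas A) B UNIV f" and B: "open_atlas B"
  shows "twice_differentiable_into B (\<lambda>w. f (TTG_point G \<kappa> z w)) 0"
proof -
  obtain V \<phi> where V: "(V, \<phi>) \<in> A" "fst z \<in> V"
    using open_atlas_cover[OF open_atlas] .
  have chart': "(V \<times> UNIV, map_prod \<phi> id) \<in> TTG_atlas A"
  proof -
    have vec: "(UNIV, id) \<in> vec_atlas"
      by (simp add: vec_atlas_def)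
    show ?thesis
      using prod_atlasI[OF V(1) prod_atlasI[OF vec prod_atlasI[OF vec vec]]]
      by (simp add: TTG_atlas_def prod.map_id0)
  qed
  have p: "twice_differentiable_at (\<lambda>w. \<phi> (fst z \<otimes> pt (fst w))) (0 :: 'e \<times> 'e \<times> 'e dual \<times> 'e dual)"
    using V by (intro twice_differentiable_into_chart[OF _ V(1)] twice_differentiable_mult
        twice_differentiable_into_const twice_differentiable_pt twice_differentiable_fst twice_differentiable_id)
      (simp_all add: zero_in_coord_dom)
  show ?thesis
  proof (rule twice_differentiable_into_manifold_map_chart[OF f open_UNIV UNIV_I open_atlas_TTG B _ chart'])
    show "isCont (TTG_point G \<kappa> z) 0"
      by (rule isCont_TTG_point) (simp add: zero_in_coord_dom)
    show "TTG_point G \<kappa> z 0 \<in> V \<times> UNIV"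
      using V by (simp add: TTG_point_eq mem_Times_iff)
    fix H :: "'e \<times> 'e \<times> 'e dual \<times> 'e dual \<Rightarrow> 'f"
    assume "twice_differentiable_at H (map_prod \<phi> id (TTG_point G \<kappa> z 0))"
    then show "twice_differentiable_at (\<lambda>w. H (map_prod \<phi> id (TTG_point G \<kappa> z w))) 0"
      using twice_differentiable_compose_affine[OF _ p bounded_linear_snd, of H "snd z"]
      by (simp add: TTG_point_eq map_prod_def case_prod_unfold)
  qed
qed

lemma maurer_cartan_zero: "maurer_cartan 0 v = v"
proof -
  have "\<forall>\<^sub>F y in nhds 0. cd (inv (pt 0) \<otimes> pt y) = y"
    using eventually_coord_dom by eventually_elim simp
  then have "maurer_cartan 0 = (\<lambda>v. v)"
    by (rule has_derivative_unique_nhds[OF has_derivative_maurer_cartan[OF zero_in_coord_dom] has_derivative_ident])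
  then show ?thesis by simp
qed

lemma linear_maurer_cartan: "x \<in> coord_dom \<Longrightarrow> linear (maurer_cartan x)"
  by (rule has_derivative_linear[OF has_derivative_maurer_cartan])

text \<open>The constant factor g cancels in f(x)^-1 f(y), leaving the Maurer--Cartan form at
  \<open>u x\<close>.\<close>

lemma has_derivative_left_translate:
  assumes "(u has_derivative u') (at x)" "u x \<in> coord_dom"
    and "\<forall>\<^sub>F y in nhds x. f y = g \<otimes> pt (u y)"
  shows "((\<lambda>y. cd (inv (f x) \<otimes> f y)) has_derivative (\<lambda>v. maurer_cartan (u x) (u' v))) (at x)"
proof -
  have "((\<lambda>y. cd (inv (pt (u x)) \<otimes> pt (u y))) has_derivative (\<lambda>v. maurer_cartan (u x) (u' v))) (at x)"
    by (rule has_derivative_compose[OF assms(1) has_derivative_maurer_cartan[OF assms(2)]])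
  moreover have "\<forall>\<^sub>F y in nhds x. cd (inv (pt (u x)) \<otimes> pt (u y)) = cd (inv (f x) \<otimes> f y)"
    using assms(3)
    by eventually_elim (simp add: eventually_nhds_x_imp_x[OF assms(3)] inv_mult_group m_assoc)
  ultimately show ?thesis
    by (simp add: has_derivative_cong_nhds)
qed

end

section \<open>Symplecticity of the discrete flow\<close>

context discrete_hohp
begin

lemma initial_cond_node:
  assumes "initial_cond G \<kappa> \<tau> h a b \<gamma> = z"
  shows "node_g \<gamma> 0 = fst z" "node_xi \<gamma> 0 = fst (snd z)"
  using assms by (auto simp: initial_cond_def)

text \<open>Antisymmetrising the derivative of dS gives \<omega> minus its pullback: the second
  derivatives of positions cancel by symmetry, the derivatives of momenta give the canonical
  pairings, and those of the Maurer--Cartan form give the brackets.\<close>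

lemma pullback_omega_eq:
  assumes elim: "eliminable G A \<kappa> U \<tau> l h a b N"
    and flow: "discrete_flow G A \<kappa> U \<tau> l h a b N F"
  shows "pullback G \<kappa> F (omega G \<kappa>) z v1 v2 = omega G \<kappa> z v1 v2"
proof -
  \<comment> \<open>Written with \<open>THE\<close> so that it is literally the family whose
    smoothness \<open>eliminable\<close> asserts.\<close>
  define \<Gamma> where "\<Gamma> z = (THE \<gamma>. path_solution \<gamma> \<and> initial_cond G \<kappa> \<tau> h a b \<gamma> = z)" for z
  have "\<exists>!\<gamma>. path_solution \<gamma> \<and> initial_cond G \<kappa> \<tau> h a b \<gamma> = z" for z
    using elim unfolding eliminable_def by (rule conjunct1[THEN spec])
  then have "path_solution (\<Gamma> z) \<and> initial_cond G \<kappa> \<tau> h a b (\<Gamma> z) = z" for z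
    unfolding \<Gamma>_def by (rule theI')
  then have sol: "path_solution (\<Gamma> z)" and init: "initial_cond G \<kappa> \<tau> h a b (\<Gamma> z) = z" for z
    by auto
  have F: "F z = node G \<kappa> \<tau> h b (\<Gamma> z) 1" for z
  proof -
    have "\<forall>k\<in>{1..N}. (F ^^ k) (initial_cond G \<kappa> \<tau> h a b (\<Gamma> z)) = node G \<kappa> \<tau> h b (\<Gamma> z) k"
      using flow sol by (simp add: discrete_flow_def)
    from bspec[OF this, of 1] show ?thesis
      using N_pos by (simp add: init)
  qed
  have F_smooth: "manifold_map smooth_on (TTG_atlas A) (TTG_atlas A) UNIV F"
    using flow by (simp add: discrete_flow_def)
  have "smooth_path_family A N \<Gamma>"
    using elim unfolding eliminable_def \<Gamma>_def[abs_def] by (rule conjunct2)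
  then have stage_smooth: "manifold_map smooth_on (TTG_atlas A) vec_atlas UNIV (\<lambda>z. st_xi (\<Gamma> z) 0 i)"
    "manifold_map smooth_on (TTG_atlas A) vec_atlas UNIV (\<lambda>z. st_v (\<Gamma> z) 0 i)" for i
    using N_pos by (simp_all add: smooth_path_family_def)

  define P where "P = TTG_point G \<kappa> z"
  obtain g \<xi> \<mu> \<nu> where z: "z = (g, \<xi>, \<mu>, \<nu>)"
    by (cases z)
  have P_eq: "P w = (g \<otimes> pt (fst w), fst (snd w) + \<xi>, fst (snd (snd w)) + \<mu>, snd (snd (snd w)) + \<nu>)" for w
    by (simp add: P_def TTG_point_eq z prod_eq_iff)
  define g1 where "g1 w = fst (F (P w))" for w
  define x1 where "x1 w = fst (snd (F (P w)))" for w
  define m1 where "m1 w = fst (snd (snd (F (P w))))" for w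
  define n1 where "n1 w = snd (snd (snd (F (P w))))" for w
  have FP: "F (P w) = (g1 w, x1 w, m1 w, n1 w)" for w
    by (simp add: g1_def x1_def m1_def n1_def)
  have P0: "P 0 = z"
    by (simp add: P_eq z zero_prod_def)
  \<comment> \<open>The group component of the image in the chart translated to \<open>g1 0\<close>;
    its derivative at 0 is the first component of the tangent map.\<close>
  define c where "c w = cd (inv (g1 0) \<otimes> g1 w)" for w

  note vec2 = open_atlas_prod[OF open_atlas_vec open_atlas_vec]
  have tdi_F: "twice_differentiable_into (TTG_atlas A) (\<lambda>w. F (P w)) 0"
    unfolding P_def by (rule twice_differentiable_TTG_point[OF F_smooth open_atlas_TTG])
  have tdi_g1: "twice_differentiable_into A g1 0"
    using twice_differentiable_into_fst[OF _ tdi_F[unfolded TTG_atlas_def]] vec2 open_atlas_prod[OF open_atlas_vec vec2]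
    by (simp add: g1_def[abs_def])
  note tdi_F' = twice_differentiable_into_snd[OF open_atlas tdi_F[unfolded TTG_atlas_def]]
  note tdi_F'' = twice_differentiable_into_snd[OF open_atlas_vec tdi_F']
  have td_x1: "twice_differentiable_at x1 0"
    using twice_differentiable_into_fst[OF vec2 tdi_F']
    by (simp add: x1_def[abs_def] twice_differentiable_into_vec)
  have td_m1: "twice_differentiable_at m1 0"
    using twice_differentiable_into_fst[OF open_atlas_vec tdi_F'']
    by (simp add: m1_def[abs_def] twice_differentiable_into_vec)
  have td_n1: "twice_differentiable_at n1 0"
    using twice_differentiable_into_snd[OF open_atlas_vec tdi_F'']
    by (simp add: n1_def[abs_def] twice_differentiable_into_vec)
  have tdi_c: "twice_differentiable_into A (\<lambda>w. inv (g1 0) \<otimes> g1 w) 0"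
    by (intro twice_differentiable_mult twice_differentiable_into_const tdi_g1)
  have td_c: "twice_differentiable_at c 0"
    unfolding c_def[abs_def] by (rule twice_differentiable_cd[OF tdi_c]) (simp add: kappa)
  have c0: "c 0 = 0"
    by (simp add: c_def)

  obtain c' c'' where c2: "has_second_derivative c c' c'' 0"
    using td_c unfolding twice_differentiable_at_def by blast
  obtain x' x'' where x2: "has_second_derivative x1 x' x'' 0"
    using td_x1 unfolding twice_differentiable_at_def by blast
  have c': "\<forall>\<^sub>F w in nhds 0. (c has_derivative c' w) (at w)"
    "\<And>v. ((\<lambda>w. c' w v) has_derivative (\<lambda>k. c'' k v)) (at 0)"
    using c2 by (auto simp: has_second_derivative_def)
  have x': "\<forall>\<^sub>F w in nhds 0. (x1 has_derivative x' w) (at w)"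
    "\<And>v. ((\<lambda>w. x' w v) has_derivative (\<lambda>k. x'' k v)) (at 0)"
    using x2 by (auto simp: has_second_derivative_def)
  note c'0 = eventually_nhds_x_imp_x[OF c'(1)] and x'0 = eventually_nhds_x_imp_x[OF x'(1)]
  obtain m' where m': "(m1 has_derivative m') (at 0)"
    using twice_differentiable_imp_differentiable[OF td_m1] by (auto simp: differentiable_def)
  obtain n' where n': "(n1 has_derivative n') (at 0)"
    using twice_differentiable_imp_differentiable[OF td_n1] by (auto simp: differentiable_def)
  have tangent: "tangent_map G \<kappa> F z v = (c' 0 v, x' 0 v, m' v, n' v)" for v
  proof -
    have "((\<lambda>w. (c w, x1 w - x1 0, m1 w - m1 0, n1 w - n1 0)) has_derivative
        (\<lambda>v. (c' 0 v, x' 0 v, m' v, n' v))) (at 0)"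
      by (auto intro!: derivative_eq_intros c'0 x'0 m' n')
    moreover have "TTG_diff G \<kappa> (F z) (F (TTG_point G \<kappa> z w)) = (c w, x1 w - x1 0, m1 w - m1 0, n1 w - n1 0)" for w
      using FP[of w] FP[of 0] by (simp add: P0 TTG_diff_def c_def flip: P_def)
    ultimately show ?thesis
      by (simp add: tangent_map_def frechet_derivative_at[symmetric])
  qed

  obtain L where L: "\<And>v. ((\<lambda>x. maurer_cartan x v) has_derivative (\<lambda>k. L k v)) (at 0)"
    and bracket: "\<And>k v. L k v - L v k = - lie_bracket G \<kappa> k v"
    using has_derivative_maurer_cartan_zero by blast

  define S where "S w = h * (\<Sum>i\<in>UNIV. b i * l (st_xi (\<Gamma> (P w)) 0 i, st_v (\<Gamma> (P w)) 0 i))" for w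
  \<comment> \<open>The canonical one-form at \<open>F (P w)\<close> minus that at
    \<open>P w\<close>. For w other than 0 the left-trivialised velocities carry Maurer--Cartan
    factors.\<close>
  define S' where "S' w v = blinfun_apply (m1 w) (maurer_cartan (c w) (c' w v)) + blinfun_apply (n1 w) (x' w v)
      - blinfun_apply (fst (snd (snd w)) + \<mu>) (maurer_cartan (fst w) (fst v))
      - blinfun_apply (snd (snd (snd w)) + \<nu>) (fst (snd v))" for w v
  \<comment> \<open>Here v is frozen and w is differentiated along k. At 0 the Maurer--Cartan form
    is the identity, so it is visible only through its derivative L.\<close>
  define S'' where "S'' k v =
      (blinfun_apply (m1 0) (L (c' 0 k) (c' 0 v) + c'' k v) + blinfun_apply (m' k) (c' 0 v))
      + (blinfun_apply (n1 0) (x'' k v) + blinfun_apply (n' k) (x' 0 v))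
      - (blinfun_apply \<mu> (L (fst k) (fst v)) + blinfun_apply (fst (snd (snd k))) (fst v))
      - blinfun_apply (snd (snd (snd k))) (fst (snd v))" for k v

  have ev_dom: "\<forall>\<^sub>F w in nhds (0 :: 'e \<times> 'e \<times> 'e dual \<times> 'e dual). fst w \<in> coord_dom"
    using open_coord_dom zero_in_coord_dom
    by (intro eventually_in_open_isCont) (auto intro: continuous_intros)
  have ev_g1: "\<forall>\<^sub>F w in nhds 0. inv (g1 0) \<otimes> g1 w \<in> fst \<kappa>"
    by (rule eventually_in_open_isCont[OF twice_differentiable_into_isCont[OF tdi_c] kappa_chart(1)])
      (simp add: kappa)
  then have "\<forall>\<^sub>F w in nhds 0. g1 w = g1 0 \<otimes> pt (c w)"
    by eventually_elim (simp add: c_def)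
  \<comment> \<open>A derivative at each w near 0 needs the identity on a neighbourhood of w, hence
    the nested quantifiers.\<close>
  then have ev_g1': "\<forall>\<^sub>F w in nhds 0. \<forall>\<^sub>F y in nhds w. g1 y = g1 0 \<otimes> pt (c y)"
    by (simp only: eventually_eventually)
  have ev_c: "\<forall>\<^sub>F w in nhds 0. c w \<in> coord_dom"
    using ev_g1 by eventually_elim (simp add: c_def cd_in_coord_dom)
  have "\<forall>\<^sub>F w in nhds 0. (\<lambda>w. st_xi (\<Gamma> (P w)) 0 i) differentiable at w"
    "\<forall>\<^sub>F w in nhds 0. (\<lambda>w. st_v (\<Gamma> (P w)) 0 i) differentiable at w" for i
    using twice_differentiable_TTG_point[OF stage_smooth(1)[of i] open_atlas_vec, of z]
      twice_differentiable_TTG_point[OF stage_smooth(2)[of i] open_atlas_vec, of z]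
    by (simp_all only: P_def twice_differentiable_into_vec twice_differentiable_imp_eventually_differentiable)
  then have ev_stage: "\<forall>\<^sub>F w in nhds 0. \<forall>i. (\<lambda>w. st_xi (\<Gamma> (P w)) 0 i) differentiable at w"
    "\<forall>\<^sub>F w in nhds 0. \<forall>i. (\<lambda>w. st_v (\<Gamma> (P w)) 0 i) differentiable at w"
    by (auto intro: eventually_all_finite)

  have S': "\<forall>\<^sub>F w in nhds 0. (S has_derivative S' w) (at w)"
    using ev_dom ev_c ev_g1' ev_stage c'(1) x'(1)
  proof eventually_elim
    case (elim w)
    have cont_P: "isCont P w"
      unfolding P_def using elim(1) by (rule isCont_TTG_point)
    have "continuous_on UNIV F"
      using F_smooth by (simp only: manifold_map_def)
    then have "isCont F (P w)"
      by (simp only: continuous_on_eq_continuous_at[OF open_UNIV] UNIV_I ball_simps)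
    note cont_F = isCont_o2[OF cont_P this]
    have node1: "node_g (\<Gamma> (P w)) 1 = g1 w" "node_xi (\<Gamma> (P w)) 1 = x1 w" for w
      using F[of "P w"] by (simp_all add: node_def FP)
    have node0: "node_g (\<Gamma> (P w)) 0 = g \<otimes> pt (fst w)" "node_xi (\<Gamma> (P w)) 0 = fst (snd w) + \<xi>" for w
      using initial_cond_node[OF init[of "P w"]] by (simp_all add: P_eq)
    show ?case
      unfolding S_def[abs_def] S'_def[abs_def]
    proof (rule has_derivative_first_step)
      show "path_solution (\<Gamma> (P w))" for w
        by (rule sol)
      show "initial_cond G \<kappa> \<tau> h a b (\<Gamma> (P w)) =
          (g \<otimes> pt (fst w), fst (snd w) + \<xi>, fst (snd (snd w)) + \<mu>, snd (snd (snd w)) + \<nu>)"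
        by (simp add: init P_eq)
      show "node G \<kappa> \<tau> h b (\<Gamma> (P w)) 1 = (g1 w, x1 w, m1 w, n1 w)"
        by (simp only: FP F[symmetric])
      show "isCont (\<lambda>w. node_g (\<Gamma> (P w)) 0) w"
        unfolding node0 using isCont_fst[OF cont_P] by (simp only: P_eq fst_conv)
      show "isCont (\<lambda>w. node_g (\<Gamma> (P w)) 1) w"
        unfolding node1 using isCont_fst[OF cont_F] by (simp only: g1_def)
      show "((\<lambda>y. cd (inv (g \<otimes> pt (fst w)) \<otimes> node_g (\<Gamma> (P y)) 0)) has_derivative
          (\<lambda>v. maurer_cartan (fst w) (fst v))) (at w)"
        unfolding node0
        by (rule has_derivative_left_translate[where u = fst and g = g])
          (use elim(1) in \<open>simp_all add: bounded_linear_imp_has_derivative bounded_linear_fst\<close>)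
      show "((\<lambda>y. cd (inv (g1 w) \<otimes> node_g (\<Gamma> (P y)) 1)) has_derivative
          (\<lambda>v. maurer_cartan (c w) (c' w v))) (at w)"
        unfolding node1 by (rule has_derivative_left_translate[OF elim(6) elim(2) elim(3)])
      show "((\<lambda>w. node_xi (\<Gamma> (P w)) 0) has_derivative (\<lambda>v. fst (snd v))) (at w)"
        unfolding node0 by (auto intro!: derivative_eq_intros)
      show "((\<lambda>w. node_xi (\<Gamma> (P w)) 1) has_derivative x' w) (at w)"
        unfolding node1 by (rule elim(7))
      show "(\<lambda>w. st_xi (\<Gamma> (P w)) 0 i) differentiable at w" "(\<lambda>w. st_v (\<Gamma> (P w)) 0 i) differentiable at w" for i
        using elim(4,5) by simp_all
    qed
  qed

  have S'': "((\<lambda>w. S' w v) has_derivative (\<lambda>k. S'' k v)) (at 0)" for v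
  proof -
    note blinfun_deriv = bounded_bilinear.FDERIV[OF bounded_bilinear_blinfun_apply]
    have "((\<lambda>w. maurer_cartan (c w) (c' w v)) has_derivative
        (\<lambda>k. L (c' 0 k) (c' 0 v) + maurer_cartan (c 0) (c'' k v))) (at 0)"
    proof (rule has_derivative_family_apply[OF _ _ c'(2)])
      show "((\<lambda>w. maurer_cartan (c w) e) has_derivative (\<lambda>k. L (c' 0 k) e)) (at 0)" for e
        by (rule has_derivative_compose_eq[OF c'0 c0 L])
      show "\<forall>\<^sub>F w in nhds 0. linear (maurer_cartan (c w))"
        using ev_c by eventually_elim (rule linear_maurer_cartan)
    qed
    from blinfun_deriv[OF m' this]
    have 1: "((\<lambda>w. blinfun_apply (m1 w) (maurer_cartan (c w) (c' w v))) has_derivative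
        (\<lambda>k. blinfun_apply (m1 0) (L (c' 0 k) (c' 0 v) + c'' k v) + blinfun_apply (m' k) (c' 0 v))) (at 0)"
      by (simp add: c0 maurer_cartan_zero)
    have 2: "((\<lambda>w. blinfun_apply (n1 w) (x' w v)) has_derivative
        (\<lambda>k. blinfun_apply (n1 0) (x'' k v) + blinfun_apply (n' k) (x' 0 v))) (at 0)"
      by (rule blinfun_deriv[OF n' x'(2)])
    have "((\<lambda>w. maurer_cartan (fst w) (fst v)) has_derivative (\<lambda>k. L (fst k) (fst v)))
        (at (0 :: 'e \<times> 'e \<times> 'e dual \<times> 'e dual))"
      by (rule has_derivative_compose_eq[OF bounded_linear_imp_has_derivative[OF bounded_linear_fst] _ L]) simp
    moreover have "((\<lambda>w. fst (snd (snd w)) + \<mu>) has_derivative (\<lambda>k. fst (snd (snd k))))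
        (at (0 :: 'e \<times> 'e \<times> 'e dual \<times> 'e dual))"
      by (auto intro!: derivative_eq_intros)
    ultimately have 3: "((\<lambda>w. blinfun_apply (fst (snd (snd w)) + \<mu>) (maurer_cartan (fst w) (fst v))) has_derivative
        (\<lambda>k. blinfun_apply \<mu> (L (fst k) (fst v)) + blinfun_apply (fst (snd (snd k))) (fst v)))
        (at (0 :: 'e \<times> 'e \<times> 'e dual \<times> 'e dual))"
      by (auto dest: blinfun_deriv simp: maurer_cartan_zero)
    have 4: "((\<lambda>w. blinfun_apply (snd (snd (snd w)) + \<nu>) (fst (snd v))) has_derivative
        (\<lambda>k. blinfun_apply (snd (snd (snd k))) (fst (snd v)))) (at (0 :: 'e \<times> 'e \<times> 'e dual \<times> 'e dual))"
      by (rule bounded_linear.has_derivative[OF blinfun.bounded_linear_left]) (auto intro!: derivative_eq_intros)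
    show ?thesis
      unfolding S'_def S''_def
      by (rule has_derivative_diff[OF has_derivative_diff[OF has_derivative_add[OF 1 2] 3] 4])
  qed
  have "has_second_derivative S S' S'' 0"
    unfolding has_second_derivative_def using S' S'' by blast
  then have sym: "S'' v1 v2 = S'' v2 v1"
    by (rule second_derivative_symmetric_real)
  \<comment> \<open>Applied below in two fixed instances, since as a general rewrite rule it would
    loop.\<close>
  have L_swap: "L u v = L v u - lie_bracket G \<kappa> u v" for u v
    using bracket[of u v] by (simp add: algebra_simps)
  obtain p1 q1 r1 s1 where v1: "v1 = (p1, q1, r1, s1)"
    by (cases v1)
  obtain p2 q2 r2 s2 where v2: "v2 = (p2, q2, r2, s2)"
    by (cases v2)
  have Fz: "F z = (g1 0, x1 0, m1 0, n1 0)"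
    using FP[of 0] by (simp add: P0)
  show ?thesis
    using sym second_derivative_symmetric[OF c2, of v1 v2] second_derivative_symmetric[OF x2, of v1 v2]
    unfolding pullback_def tangent Fz S''_def
      L_swap[of "c' 0 v1" "c' 0 v2"] L_swap[of "fst v1" "fst v2"]
    by (simp add: omega_def z v1 v2 blinfun.add_right blinfun.diff_right)
qed

end

theorem mainTheorem5:
  fixes G :: "'g::{t2_space, second_countable_topology} monoid"
    and A :: "('g, 'e::euclidean_space) chart set"
    and \<kappa> :: "('g, 'e) chart"
    and U :: "'e set" and \<tau> :: "'e \<Rightarrow> 'g"
    and l :: "'e \<times> 'e \<Rightarrow> real"
    and h :: real and a :: "'s::finite \<Rightarrow> 's \<Rightarrow> real" and b :: "'s \<Rightarrow> real"
    and N :: nat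
    and F :: "'g \<times> 'e \<times> 'e dual \<times> 'e dual \<Rightarrow> 'g \<times> 'e \<times> 'e dual \<times> 'e dual"
  assumes "lie_group G A" and "unit_chart G A \<kappa>"
    and "local_diffeo_at_unit G A U \<tau>"
    and "smooth_on UNIV l"
    and "h > 0" and "N \<ge> 1"
    and "eliminable G A \<kappa> U \<tau> l h a b N"
    and "discrete_flow G A \<kappa> U \<tau> l h a b N F"
  shows "pullback G \<kappa> F (omega G \<kappa>) = omega G \<kappa>"
proof -
  interpret discrete_hohp G A \<kappa> U \<tau> l h a b N
    using assms by unfold_locales
  show ?thesis
    using pullback_omega_eq[OF assms(7,8)] by (intro ext)
qed

end
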